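(* Let $(\Xi,d)$ be a Polish space, $\nu=\frac1N\sum_{i=1}^N\delta_{\hat\xi^i}$ with $\hat\xi^1,\dots,\hat\xi^N\in\Xi$, $\Psi:\Xi\to\mathbb R$ with $\Psi\in L^1(\nu)$, $p\in[1,\infty)$ and $\theta>0$. The following hold. (i) [Strong duality] The primal problem defining $v_P$ has a strong dual problem: $$v_P=v_D=\inf_{\lambda\ge0}\Big\{\lambda\theta^p-\frac1N\sum_{i=1}^N\inf_{\xi\in\Xi}\big[\lambda d^p(\xi,\hat\xi^i)-\Psi(\xi)\big]\Big\}.$$ (ii) [Structure of the worst-case distribution] Whenever a worst-case distribution exists, there exists one which is supported on at most $N+1$ points and has the form $$\mu^*=\frac1N\sum_{i\ne i_0}\delta_{\xi^i_*}+\frac{p_0}{N}\,\delta_{\underline\xi^{i_0}_*}+\frac{1-p_0}{N}\,\delta_{\overline\xi^{i_0}_*},$$ where $i_0\in\{1,\dots,N\}$, $p_0\in[0,1]$, $\underline\xi^{i_0}_*,\overline\xi^{i_0}_*\in\arg\min_{\xi\in\Xi}\{\lambda^*d^p(\xi,\hat\xi^{i_0})-\Psi(\xi)\}$, and $\xi^i_*\in\arg\min_{\xi\in\Xi}\{\lambda^*d^p(\xi,\hat\xi^i)-\Psi(\xi)\}$ for all $i\ne i_0$. (iii) [Approximation by robust optimization] Suppose that there exist $\zeta^0\in\Xi$ and $L,M\ge0$ such that $|\Psi(\xi)-\Psi(\zeta^0)|<L\,d^p(\xi,\zeta^0)+M$ for all $\xi\in\Xi$. For any positive integer $K$, consider the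 robust optimization problem $$v_K:=\sup_{(\xi^{ik})_{i,k}\in\mathfrak M_K}\frac1{NK}\sum_{i=1}^N\sum_{k=1}^K\Psi(\xi^{ik})$$ with uncertainty set $$\mathfrak M_K:=\Big\{(\xi^{ik})_{i,k}:\ \frac1{NK}\sum_{i=1}^N\sum_{k=1}^Kd^p(\xi^{ik},\hat\xi^i)\le\theta^p,\ \xi^{ik}\in\Xi\ \forall\,i,k\Big\}.$$ If $\lambda^*>\kappa$, then there exists a constant $D$ independent of $K$ such that $$v_K\ \le\ \sup_{\mu\in\mathcal P(\Xi):\,W_p(\mu,\nu)\le\theta}\mathbb E_\mu[\Psi(\xi)]\ \le\ v_K+\frac{LD+M}{NK}.$$ In addition, if $\Xi$ is convex and $\Psi$ is concave, then $v_1=v_P=v_D$.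
   Context: $\mathcal P(\Xi)$ is the set of Borel probability measures on $\Xi$, $\delta_\xi$ the unit mass at $\xi$, $d^p(\xi,\zeta):=d(\xi,\zeta)^p$, and $W_p^p(\mu,\nu)=\min_\gamma\int d^p\,d\gamma$ over $\gamma\in\mathcal P(\Xi\times\Xi)$ with marginals $\mu$ and $\nu$. $L^1(\nu)$ is the $L^1$ space of $\nu$-measurable functions (measurable with respect to the $\nu$-completion of the Borel $\sigma$-algebra). $v_P:=\sup\{\int_\Xi\Psi\,d\mu:\mu\in\mathcal P(\Xi),\ W_p(\mu,\nu)\le\theta\}$ (the primal problem); a worst-case distribution is a feasible $\mu$ attaining this supremum. Let $\Phi(\lambda,\zeta):=\inf_{\xi\in\Xi}\{\lambda d^p(\xi,\zeta)-\Psi(\xi)\}$, let $h(\lambda):=\lambda\theta^p-\int_\Xi\Phi(\lambda,\zeta)\,\nu(d\zeta)=\lambda\theta^p-\frac1N\sum_{i=1}^N\Phi(\lambda,\hat\xi^i)$ for $\lambda\ge0$, and $v_D:=\inf_{\lambda\ge0}h(\lambda)$. $\lambda^*$ denotes a dual minimizer, i.e. a minimizer of $h$ over $[0,\infty)$. The growth rate of $\Psi$ is $\kappa:=\inf\{\lambda\ge0:\int_\Xi\Phi(\lambda,\zeta)\,\nu(d\zeta)>-\infty\}$ ($\inf\varnothing=\infty$).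
   Formalization: In (ii) a worst-case distribution must attain a finite v_P (else (ii) is false); in (iii) the upper bound is claimed only for L>0 (false for L=0 in general); "Ξ convex" means a convex subset of a real vector space on which d(·,ζ) is convex. *)

theory Defs
  imports "HOL-Probability.Probability"
begin

definition borel_prob :: "'a::topological_space measure set" where
  "borel_prob = {\<mu>. prob_space \<mu> \<and> sets \<mu> = sets borel}"

text \<open>
  The extended-real integral of \<open>f\<close> against \<open>\<mu>\<close>, with measurability understood with respect to the
  completion of \<open>\<mu>\<close>. The function \<^term>\<open>e2ennreal\<close> sends negative arguments to \<open>0\<close>, so the two
  nonnegative integrals are those of the positive and the negative part. An integral that is not
  defined (\<open>f\<close> not measurable, or both parts of infinite integral) gets the value \<open>-\<infinity>\<close>; hence a
  measure for which the integral of the objective is undefined never contributes to a supremum.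
\<close>
definition ext_integral :: "'a measure \<Rightarrow> ('a \<Rightarrow> ereal) \<Rightarrow> ereal" where
  "ext_integral \<mu> f =
    (let P = (\<integral>\<^sup>+ x. e2ennreal (f x) \<partial>completion \<mu>);
         Q = (\<integral>\<^sup>+ x. e2ennreal (- f x) \<partial>completion \<mu>)
     in if f \<in> borel_measurable (completion \<mu>) \<and> (P < \<infinity> \<or> Q < \<infinity>)
        then enn2ereal P - enn2ereal Q else - \<infinity>)"

definition couplings ::
    "'a::metric_space measure \<Rightarrow> 'a measure \<Rightarrow> ('a \<times> 'a) measure set" where
  "couplings \<mu> \<nu> = {\<gamma> \<in> borel_prob. distr \<gamma> borel fst = \<mu> \<and> distr \<gamma> borel snd = \<nu>}"

definition transport_cost ::
    "real \<Rightarrow> 'a::metric_space measure \<Rightarrow> 'a measure \<Rightarrow> ennreal" where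
  "transport_cost p \<mu> \<nu> =
    (INF \<gamma>\<in>couplings \<mu> \<nu>. \<integral>\<^sup>+ z. ennreal (dist (fst z) (snd z) powr p) \<partial>\<gamma>)"

definition wasserstein ::
    "real \<Rightarrow> 'a::metric_space measure \<Rightarrow> 'a measure \<Rightarrow> ennreal" where
  "wasserstein p \<mu> \<nu> =
    (let c = transport_cost p \<mu> \<nu> in if c = \<infinity> then \<infinity> else ennreal (enn2real c powr (1 / p)))"

definition feasible ::
    "real \<Rightarrow> real \<Rightarrow> 'a::metric_space measure \<Rightarrow> 'a measure set" where
  "feasible p \<theta> \<nu> = {\<mu> \<in> borel_prob. wasserstein p \<mu> \<nu> \<le> ennreal \<theta>}"

definition primal_value ::
    "real \<Rightarrow> real \<Rightarrow> 'a::metric_space measure \<Rightarrow> ('a \<Rightarrow> real) \<Rightarrow> ereal" where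
  "primal_value p \<theta> \<nu> \<Psi> = (SUP \<mu>\<in>feasible p \<theta> \<nu>. ext_integral \<mu> (\<lambda>\<xi>. ereal (\<Psi> \<xi>)))"

text \<open>
  Attainment is meant for a finite optimal value. If the value is \<open>\<infinity>\<close>, every number \<open>\<ge> 0\<close>
  minimizes the dual objective, and a feasible measure with integral \<open>\<infinity>\<close> is not called a
  worst-case distribution.
\<close>
definition worst_case ::
    "real \<Rightarrow> real \<Rightarrow> 'a::metric_space measure \<Rightarrow> ('a \<Rightarrow> real) \<Rightarrow> 'a measure \<Rightarrow> bool" where
  "worst_case p \<theta> \<nu> \<Psi> \<mu> \<longleftrightarrow>
    \<mu> \<in> feasible p \<theta> \<nu> \<and> ext_integral \<mu> (\<lambda>\<xi>. ereal (\<Psi> \<xi>)) = primal_value p \<theta> \<nu> \<Psi> \<and>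
    primal_value p \<theta> \<nu> \<Psi> < \<infinity>"

definition Phi :: "real \<Rightarrow> ('a::metric_space \<Rightarrow> real) \<Rightarrow> real \<Rightarrow> 'a \<Rightarrow> ereal" where
  "Phi p \<Psi> lam \<zeta> = (INF \<xi>. ereal (lam * dist \<xi> \<zeta> powr p - \<Psi> \<xi>))"

definition dual_objective ::
    "real \<Rightarrow> real \<Rightarrow> 'a::metric_space measure \<Rightarrow> ('a \<Rightarrow> real) \<Rightarrow> real \<Rightarrow> ereal" where
  "dual_objective p \<theta> \<nu> \<Psi> lam = ereal (lam * \<theta> powr p) - ext_integral \<nu> (Phi p \<Psi> lam)"

definition dual_value ::
    "real \<Rightarrow> real \<Rightarrow> 'a::metric_space measure \<Rightarrow> ('a \<Rightarrow> real) \<Rightarrow> ereal" where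
  "dual_value p \<theta> \<nu> \<Psi> = (INF lam\<in>{0..}. dual_objective p \<theta> \<nu> \<Psi> lam)"

definition dual_minimizer ::
    "real \<Rightarrow> real \<Rightarrow> 'a::metric_space measure \<Rightarrow> ('a \<Rightarrow> real) \<Rightarrow> real \<Rightarrow> bool" where
  "dual_minimizer p \<theta> \<nu> \<Psi> lam \<longleftrightarrow> is_arg_min (dual_objective p \<theta> \<nu> \<Psi>) (\<lambda>l. 0 \<le> l) lam"

definition growth_rate ::
    "real \<Rightarrow> 'a::metric_space measure \<Rightarrow> ('a \<Rightarrow> real) \<Rightarrow> ereal" where
  "growth_rate p \<nu> \<Psi> = Inf {ereal lam |lam. 0 \<le> lam \<and> ext_integral \<nu> (Phi p \<Psi> lam) > - \<infinity>}"

text \<open>The samples are indexed by \<open>1, \<dots>, N\<close>; values of \<open>\<xi>\<close> outside the index range are irrelevant.\<close>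
definition robust_set ::
    "real \<Rightarrow> real \<Rightarrow> nat \<Rightarrow> (nat \<Rightarrow> 'a::metric_space) \<Rightarrow> nat \<Rightarrow> (nat \<Rightarrow> nat \<Rightarrow> 'a) set" where
  "robust_set p \<theta> N x K =
    {\<xi>. 1 / (real N * real K) * (\<Sum>i=1..N. \<Sum>k=1..K. dist (\<xi> i k) (x i) powr p) \<le> \<theta> powr p}"

definition robust_value ::
    "real \<Rightarrow> real \<Rightarrow> nat \<Rightarrow> (nat \<Rightarrow> 'a::metric_space) \<Rightarrow> ('a \<Rightarrow> real) \<Rightarrow> nat \<Rightarrow> ereal" where
  "robust_value p \<theta> N x \<Psi> K =
    (SUP \<xi>\<in>robust_set p \<theta> N x K.
       ereal (1 / (real N * real K) * (\<Sum>i=1..N. \<Sum>k=1..K. \<Psi> (\<xi> i k))))"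

text \<open>
  Convexity of \<open>\<Xi>\<close> refers to an identification \<open>e\<close> of \<open>\<Xi>\<close> with a convex subset of a real vector
  space. The metric must respect the linear structure, in that the distance to a fixed
  point is a convex function. (For \<open>\<Xi> = [0, 1]\<close> with distance
  \<open>sqrt \<bar>x - y\<bar>\<close>, \<open>p = 1\<close>, \<open>\<theta> = 1/2\<close>, \<open>\<nu> = \<delta>\<^sub>0\<close> and \<open>\<Psi> x = x\<close>, restricting to one point per sample
  gives \<open>1/4\<close>, while the primal value is \<open>1/2\<close>.) A metric induced by a norm has this property, as
  the lemma below shows.
\<close>
definition convex_space :: "('a::metric_space \<Rightarrow> 'b::real_vector) \<Rightarrow> bool" where
  "convex_space e \<longleftrightarrow> inj e \<and> convex (range e) \<and>
    (\<forall>\<zeta>. convex_on (range e) (\<lambda>v. dist (inv e v) \<zeta>))"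

lemma convex_space_isometry:
  fixes e :: "'a::metric_space \<Rightarrow> 'b::real_normed_vector"
  assumes iso: "\<And>\<xi> \<zeta>. dist (e \<xi>) (e \<zeta>) = dist \<xi> \<zeta>" and conv: "convex (range e)"
  shows "convex_space e"
proof -
  have inj: "inj e"
    by (rule injI) (metis iso dist_eq_0_iff)
  have "convex_on (range e) (\<lambda>v. dist (inv e v) \<zeta>)" for \<zeta>
  proof -
    have "convex_on (range e) (\<lambda>v. dist (e \<zeta>) v)"
      by (rule convex_on_dist[OF conv])
    moreover have "dist (e \<zeta>) v = dist (inv e v) \<zeta>" if "v \<in> range e" for v
      using that inj iso by (auto simp: dist_commute)
    moreover have "u *\<^sub>R y + v *\<^sub>R z \<in> range e"
      if "y \<in> range e" "z \<in> range e" "0 \<le> u" "0 \<le> v" "u + v = 1" for y z u v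
      using convexD[OF conv] that by blast
    ultimately show ?thesis
      by (metis (no_types, lifting) convex_on_def)
  qed
  with inj conv show ?thesis
    by (simp add: convex_space_def)
qed

end

theory Submission
  imports Defs
begin

text \<open>
  Everything reduces to configurations: a configuration \<open>\<xi>\<close> moves the sample \<open>x i\<close> to \<open>\<xi> i\<close>, with mean cost
  \<open>c \<xi>\<close> (the average of \<open>d(\<xi> i, x i)^p\<close>) and mean payoff \<open>u \<xi>\<close> (the average of \<open>\<Psi> (\<xi> i)\<close>). A convex
  combination of configurations is a finitely supported measure, it comes with an obvious coupling to
  \<open>\<nu>\<close>, and it is feasible as soon as its averaged cost is at most \<open>\<theta>^p\<close>.

  Strong duality is a separation argument in the plane of pairs \<open>(c \<xi>, u \<xi>)\<close>. Let \<open>V\<close> be the supremum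
  of the payoff of mixtures of two configurations within the budget. If \<open>V\<close> is finite, the slope
  of every line from \<open>(\<theta>^p, V)\<close> to a configuration over budget is at most the slope of every line from a
  configuration under budget, since a mixture of the two meets the budget exactly
  (\<open>supporting_slope\<close>). A number \<open>\<lambda> \<ge> 0\<close> between these slopes satisfies \<open>h \<lambda> \<le> V\<close>, so \<open>V\<close>, the primal and the
  dual value agree and the dual is attained (\<open>strong_duality\<close>, \<open>dual_attained\<close>).

  For a worst-case distribution \<open>\<mu>\<close> and a dual minimizer \<open>\<lambda>\<close>, the slack
  \<open>\<lambda> d(\<xi>, \<zeta>)^p - \<Psi> \<xi> - \<Phi>(\<lambda>, \<zeta>) \<ge> 0\<close> has a small mean under couplings of nearly minimal cost. Such couplings
  need not converge to an optimal one, but they all have the same first marginal \<open>\<mu>\<close>, and therefore a nonnegative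
  \<open>s\<close> whose mean tends to zero forces the mean of any \<open>\<mu>\<close>-integrable function over \<open>{s > 0}\<close> to tend to zero
  (\<open>absorb_on_positive\<close>). It follows that one can choose zeros of the slack, that is argmin points, whose
  mean cost is at most \<open>\<theta>^p\<close>, and, if \<open>\<lambda> > 0\<close>, others whose mean cost is at least \<open>\<theta>^p\<close>
  (\<open>select_configuration\<close>). Passing from the first to the second choice one sample at a time, the cost crosses
  \<open>\<theta>^p\<close> at a single sample \<open>i0\<close>, and splitting the mass of that sample alone meets the budget exactly
  (\<open>split_one_sample\<close>).

  For the robust approximation, a nearly optimal mixture with weight \<open>\<alpha>\<close> is rounded to \<open>K\<close> layers of equal
  weight. The one layer that would be fractional is put at the samples themselves, where the cost is zero. The loss is
  \<open>O(1/K)\<close> because a second multiplier below \<open>\<lambda>\<close> with finite \<open>\<Phi>\<close> makes the slack coercive in the cost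
  (\<open>robust_approximation\<close>). If \<open>\<Xi>\<close> is convex and \<open>\<Psi>\<close> concave, the two points of a mixture can be replaced by
  their barycentre.
\<close>

section \<open>Integrals against finitely supported measures\<close>

lemma ext_integral_eq_integral:
  assumes "integrable (completion \<mu>) f"
  shows "ext_integral \<mu> (\<lambda>x. ereal (f x)) = ereal (integral\<^sup>L (completion \<mu>) f)"
proof -
  let ?P = "\<integral>\<^sup>+ x. ennreal (f x) \<partial>completion \<mu>" and ?Q = "\<integral>\<^sup>+ x. ennreal (- f x) \<partial>completion \<mu>"
  have fin: "?P < \<infinity>" "?Q < \<infinity>" and meas: "f \<in> borel_measurable (completion \<mu>)"
    using assms unfolding real_integrable_def by (auto simp: less_top)
  have "integral\<^sup>L (completion \<mu>) f = enn2real ?P - enn2real ?Q"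
    by (rule real_lebesgue_integral_def[OF assms])
  moreover have "enn2ereal a = ereal (enn2real a)" if "a < \<infinity>" for a
    using that by (cases a rule: ennreal_cases) auto
  ultimately show ?thesis
    using fin meas by (simp add: ext_integral_def)
qed

text \<open>
  If \<open>f\<close> is not measurable or its negative part has infinite integral, the value is \<open>-\<infinity>\<close>. Hence, once the
  positive part is known to be integrable, upper bounds only have to be shown in the integrable case.
\<close>
lemma integrable_or_ext_integral_MInf:
  assumes "(\<integral>\<^sup>+ x. ennreal (f x) \<partial>\<mu>) < \<infinity>"
  shows "integrable (completion \<mu>) f \<or> ext_integral \<mu> (\<lambda>x. ereal (f x)) = -\<infinity>"
proof -
  have "enn2ereal a - \<infinity> = -\<infinity>" if "a < \<infinity>" for a
    using that by (cases a rule: ennreal_cases) auto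
  with assms show ?thesis
    by (auto simp: ext_integral_def real_integrable_def nn_integral_completion)
qed

lemma integrable_if_ext_integral_finite:
  assumes "ext_integral \<mu> (\<lambda>x. ereal (f x)) = ereal v"
  shows "integrable (completion \<mu>) f"
proof -
  let ?P = "\<integral>\<^sup>+ x. ennreal (f x) \<partial>\<mu>" and ?Q = "\<integral>\<^sup>+ x. ennreal (- f x) \<partial>\<mu>"
  have meas: "(\<lambda>x. ereal (f x)) \<in> borel_measurable (completion \<mu>)"
    and eq: "enn2ereal ?P - enn2ereal ?Q = ereal v"
    using assms by (auto simp: ext_integral_def nn_integral_completion Let_def split: if_splits)
  have "?P \<noteq> \<infinity>" "?Q \<noteq> \<infinity>"
    using eq by (cases ?P; cases ?Q; auto simp: enn2ereal_top)+
  then show ?thesis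
    using meas by (auto simp: real_integrable_def nn_integral_completion)
qed

lemma pmf_distr_AE:
  fixes y :: "'b \<Rightarrow> 'a::t1_space"
  assumes "finite (set_pmf P)"
  shows "AE v in distr (measure_pmf P) borel y. v \<in> y ` set_pmf P"
proof -
  have "y ` set_pmf P \<in> sets borel" using assms by (intro borel_closed finite_imp_closed) auto
  then show ?thesis by (subst AE_distr_iff) (auto simp: AE_measure_pmf_iff)
qed

text \<open>
  The complement of the finite support is a null set, hence all its subsets belong to the completion.
\<close>
lemma pmf_distr_measurable:
  fixes y :: "'b \<Rightarrow> 'a::t1_space"
  assumes "finite (set_pmf P)"
  shows "f \<in> borel_measurable (completion (distr (measure_pmf P) borel y))"
proof (rule measurableI)
  fix B assume "B \<in> sets (borel :: 'c measure)"
  let ?M = "distr (measure_pmf P) borel y" and ?S = "y ` set_pmf P"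
  have S: "?S \<in> sets borel" using assms by (intro borel_closed finite_imp_closed) auto
  have "- ?S \<in> null_sets ?M"
    using pmf_distr_AE[OF assms, of y] S by (subst AE_iff_null_sets) auto
  then have "f -` B - ?S \<in> sets (completion ?M)"
    by (rule null_sets_completion) auto
  moreover have "f -` B \<inter> ?S \<in> sets (completion ?M)"
    using assms by (intro sets_completionI_sets) (auto intro!: borel_closed finite_imp_closed)
  ultimately have "(f -` B - ?S) \<union> (f -` B \<inter> ?S) \<in> sets (completion ?M)" by blast
  then show "f -` B \<inter> space (completion ?M) \<in> sets (completion ?M)"
    by (simp add: Un_Diff_Int)
qed auto

lemma nn_integral_pmf_distr:
  fixes y :: "'b \<Rightarrow> 'a::t1_space"
  assumes fin: "finite (set_pmf P)"
  shows "(\<integral>\<^sup>+ v. f v \<partial>distr (measure_pmf P) borel y) = (\<integral>\<^sup>+ j. f (y j) \<partial>measure_pmf P)"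
proof -
  let ?S = "y ` set_pmf P"
  define g where "g v = (if v \<in> ?S then f v else 0)" for v
  have g: "g \<in> borel_measurable borel"
    by (rule measurable_discrete_difference[where X="?S" and f="\<lambda>_. 0"])
      (use fin in \<open>auto simp: g_def countable_finite\<close>)
  have "(\<integral>\<^sup>+ v. f v \<partial>distr (measure_pmf P) borel y) = (\<integral>\<^sup>+ v. g v \<partial>distr (measure_pmf P) borel y)"
    by (rule nn_integral_cong_AE) (use pmf_distr_AE[OF fin, of y] in \<open>eventually_elim, simp add: g_def\<close>)
  also have "\<dots> = (\<integral>\<^sup>+ j. g (y j) \<partial>measure_pmf P)"
    by (rule nn_integral_distr) (use g in auto)
  also have "\<dots> = (\<integral>\<^sup>+ j. f (y j) \<partial>measure_pmf P)"
    by (rule nn_integral_cong_AE) (auto simp: AE_measure_pmf_iff g_def)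
  finally show ?thesis .
qed

text \<open>
  Change of variables for arbitrary \<open>f\<close>, as only the values on the finite support matter.
\<close>
lemma ext_integral_pmf_distr:
  fixes y :: "'b \<Rightarrow> 'a::t1_space"
  assumes "finite (set_pmf P)"
  shows "ext_integral (distr (measure_pmf P) borel y) f = ext_integral (measure_pmf P) (\<lambda>j. f (y j))"
proof -
  have "(\<lambda>j. f (y j)) \<in> borel_measurable (completion (measure_pmf P))"
    by (rule measurable_completion) auto
  then show ?thesis
    using pmf_distr_measurable[OF assms, of f y]
    by (simp add: ext_integral_def nn_integral_completion nn_integral_pmf_distr[OF assms])
qed

lemma ext_integral_pmf_real:
  assumes "finite (set_pmf P)" and "\<And>j. j \<in> set_pmf P \<Longrightarrow> f j = ereal (g j)"
  shows "ext_integral (measure_pmf P) f = ereal (measure_pmf.expectation P g)"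
proof -
  have meas: "h \<in> borel_measurable (completion (measure_pmf P))" for h :: "'a \<Rightarrow> 'c::topological_space"
    by (rule measurable_completion) auto
  have nn: "(\<integral>\<^sup>+ j. F (f j) \<partial>measure_pmf P) = (\<integral>\<^sup>+ j. F (ereal (g j)) \<partial>measure_pmf P)" for F :: "ereal \<Rightarrow> ennreal"
    by (rule nn_integral_cong_AE) (auto simp: AE_measure_pmf_iff assms)
  have "ext_integral (measure_pmf P) f = ext_integral (measure_pmf P) (\<lambda>j. ereal (g j))"
    using nn[of e2ennreal] nn[of "\<lambda>v. e2ennreal (- v)"]
    by (simp add: ext_integral_def nn_integral_completion meas)
  also have "\<dots> = ereal (measure_pmf.expectation P g)"
    using integrable_measure_pmf_finite[OF assms(1), of g]
    by (subst ext_integral_eq_integral) (auto simp: integrable_completion integral_completion)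
  finally show ?thesis .
qed

lemma ext_integral_pmf_MInf:
  assumes fin: "finite (set_pmf P)" and less: "\<And>j. f j < \<infinity>" and j: "j \<in> set_pmf P" "f j = -\<infinity>"
  shows "ext_integral (measure_pmf P) f = -\<infinity>"
proof -
  have "(\<integral>\<^sup>+ j. e2ennreal (f j) \<partial>measure_pmf P) = (\<Sum>j\<in>set_pmf P. e2ennreal (f j) * pmf P j)"
    by (rule nn_integral_measure_pmf_finite[OF fin zero_le])
  also have "\<dots> < \<infinity>"
  proof -
    have "e2ennreal (f j) < top" for j
      using less[of j] by (cases "f j") (auto simp: e2ennreal_ereal e2ennreal_neg)
    then show ?thesis by (auto simp: fin ennreal_mult_less_top)
  qed
  finally have P: "(\<integral>\<^sup>+ j. e2ennreal (f j) \<partial>measure_pmf P) < \<infinity>" .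
  have "(\<integral>\<^sup>+ j. e2ennreal (- f j) \<partial>measure_pmf P) = (\<Sum>j\<in>set_pmf P. e2ennreal (- f j) * pmf P j)"
    by (rule nn_integral_measure_pmf_finite[OF fin zero_le])
  also have "\<dots> = \<infinity>"
  proof -
    have "pmf P j > 0" using j(1) by (simp add: pmf_positive)
    then have "e2ennreal (- f j) * ennreal (pmf P j) = top"
      by (simp add: j(2) ennreal_top_mult)
    then show ?thesis using ennreal_sum_eq_top[OF fin] j(1) by auto
  qed
  finally have Q: "(\<integral>\<^sup>+ j. e2ennreal (- f j) \<partial>measure_pmf P) = \<infinity>" .
  have "f \<in> borel_measurable (completion (measure_pmf P))"
    by (rule measurable_completion) auto
  moreover have "enn2ereal a - \<infinity> = -\<infinity>" if "a < \<infinity>" for a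
    using that by (cases a rule: ennreal_cases) auto
  ultimately show ?thesis using P Q
    by (auto simp: ext_integral_def nn_integral_completion)
qed

text \<open>
  Fubini for a uniformly distributed sample index paired with an independent layer.
\<close>
lemma expectation_pmf_of_set_pair:
  fixes g :: "nat \<Rightarrow> 'b \<Rightarrow> real"
  assumes "N \<ge> 1" and "finite (set_pmf Q)"
  shows "measure_pmf.expectation (pair_pmf (pmf_of_set {1..N}) Q) (\<lambda>(i, k). g i k) =
    measure_pmf.expectation Q (\<lambda>k. 1 / real N * (\<Sum>i=1..N. g i k))"
proof -
  have "measure_pmf.expectation (pair_pmf (pmf_of_set {1..N}) Q) (\<lambda>(i, k). g i k) =
      (\<Sum>(i,k)\<in>{1..N} \<times> set_pmf Q. g i k * (pmf Q k / real N))"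
    using assms by (subst integral_measure_pmf_real[where A="{1..N} \<times> set_pmf Q"])
      (auto simp: pmf_pair split_beta intro!: sum.cong)
  also have "\<dots> = (\<Sum>k\<in>set_pmf Q. \<Sum>i=1..N. g i k * (pmf Q k / real N))"
    by (subst sum.swap) (simp add: sum.cartesian_product)
  also have "\<dots> = measure_pmf.expectation Q (\<lambda>k. 1 / real N * (\<Sum>i=1..N. g i k))"
    using assms by (subst integral_measure_pmf_real[where A="set_pmf Q"])
      (auto simp: sum_distrib_right sum_distrib_left intro!: sum.cong)
  finally show ?thesis .
qed

text \<open>
  Keeps the index range \<open>{1..N}\<close> from being rewritten to \<open>{Suc 0..N}\<close>.
\<close>
declare One_nat_def [simp del]

lemma empirical_measure_eq_distr:
  fixes \<nu> :: "'a::polish_space measure" and x :: "nat \<Rightarrow> 'a"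
  assumes N: "N \<ge> 1" and prob: "\<nu> \<in> borel_prob"
    and eq: "\<And>A. A \<in> sets borel \<Longrightarrow>
      measure \<nu> A = 1 / real N * (\<Sum>i=1..N. measure (return borel (x i)) A)"
  shows "\<nu> = distr (measure_pmf (pmf_of_set {1..N})) borel x"
proof (rule measure_eqI)
  let ?P = "pmf_of_set {1..N}"
  show sets: "sets \<nu> = sets (distr (measure_pmf ?P) borel x)"
    using prob by (simp add: borel_prob_def)
  fix A assume "A \<in> sets \<nu>"
  then have A: "A \<in> sets borel" using prob by (simp add: borel_prob_def)
  interpret \<nu>: prob_space \<nu> using prob by (simp add: borel_prob_def)
  interpret D: prob_space "distr (measure_pmf ?P) borel x"
    by (rule measure_pmf.prob_space_distr) simp
  have "measure (distr (measure_pmf ?P) borel x) A = measure (measure_pmf ?P) (x -` A)"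
    using A by (simp add: measure_distr)
  also have "\<dots> = measure_pmf.expectation ?P (indicator (x -` A))" by simp
  also have "\<dots> = 1 / real N * (\<Sum>i=1..N. indicator A (x i))"
    using N by (subst integral_pmf_of_set) (auto simp: indicator_def)
  also have "\<dots> = measure \<nu> A"
    unfolding eq[OF A] using A by (simp add: measure_return)
  finally show "emeasure \<nu> A = emeasure (distr (measure_pmf ?P) borel x) A"
    by (simp add: \<nu>.emeasure_eq_measure D.emeasure_eq_measure)
qed

section \<open>Elementary inequalities and sums\<close>

text \<open>
  The sum that arises when a mixture of two configurations is rounded to \<open>K\<close> layers of equal weight.
\<close>
lemma sum_three_layers:
  fixes g :: "'c \<Rightarrow> real"
  assumes "m < K"
  shows "(\<Sum>k=1..K. g (if k \<le> m then a else if k < K then b else c))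
    = real m * g a + (real K - 1 - real m) * g b + g c"
proof -
  let ?f = "\<lambda>k. g (if k \<le> m then a else if k < K then b else c)"
  have split: "{1..K} = {1..m} \<union> ({m<..<K} \<union> {K})" using assms by auto
  have "(\<Sum>k=1..K. ?f k) = (\<Sum>k=1..m. ?f k) + ((\<Sum>k\<in>{m<..<K}. ?f k) + ?f K)"
    unfolding split using assms by (subst sum.union_disjoint, auto)+
  also have "(\<Sum>k=1..m. ?f k) = (\<Sum>k=1..m. g a)" by (rule sum.cong) auto
  also have "(\<Sum>k\<in>{m<..<K}. ?f k) = (\<Sum>k\<in>{m<..<K}. g b)" by (rule sum.cong) auto
  finally show ?thesis using assms by (simp add: of_nat_diff)
qed

text \<open>
  Convexity of \<open>t powr p\<close> on the closed half-line; the endpoint \<open>0\<close> is treated by \<open>r powr p \<le> r\<close> for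
  \<open>0 \<le> r \<le> 1\<close>.
\<close>
lemma powr_convex_combination:
  fixes a b u v p :: real
  assumes p: "1 \<le> p" and "0 \<le> a" "0 \<le> b" "0 \<le> u" "0 \<le> v" "u + v = 1"
  shows "(u * a + v * b) powr p \<le> u * a powr p + v * b powr p"
proof -
  have shrink: "(r * c) powr p \<le> r * c powr p" if "0 \<le> r" "r \<le> 1" "0 \<le> c" for r c :: real
  proof -
    have "r powr p \<le> r powr 1" if "r \<noteq> 0"
      using p \<open>0 \<le> r\<close> \<open>r \<le> 1\<close> that by (intro powr_mono') auto
    then have "r powr p \<le> r" using that by (cases "r = 0") auto
    then show ?thesis using that by (simp add: powr_mult mult_right_mono)
  qed
  consider "a = 0" | "b = 0" | "0 < a" "0 < b" using assms by linarith
  then show ?thesis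
  proof cases
    case 3
    then show ?thesis
      using powr_convex[OF p] assms by (auto simp: convex_on_def)
  qed (use assms shrink[of v b] shrink[of u a] p in auto)
qed

section \<open>Empirical data, configurations and mixtures\<close>

locale empirical_dro =
  fixes \<nu> :: "'a::polish_space measure" and x :: "nat \<Rightarrow> 'a" and N :: nat
    and \<Psi> :: "'a \<Rightarrow> real" and p \<theta> :: real
  assumes N: "N \<ge> 1"
    and nu: "\<nu> = distr (measure_pmf (pmf_of_set {1..N})) borel x"
    and p: "1 \<le> p" and theta: "0 < \<theta>"
begin

definition avg :: "(nat \<Rightarrow> real) \<Rightarrow> real" where
  "avg g = 1 / real N * (\<Sum>i=1..N. g i)"

definition cost :: "(nat \<Rightarrow> 'a) \<Rightarrow> real" where
  "cost \<xi> = avg (\<lambda>i. dist (\<xi> i) (x i) powr p)"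

definition payoff :: "(nat \<Rightarrow> 'a) \<Rightarrow> real" where
  "payoff \<xi> = avg (\<lambda>i. \<Psi> (\<xi> i))"

text \<open>
  The law of \<open>\<xi> k i\<close> for a uniform sample index \<open>i\<close> and an independent layer \<open>k\<close>. Every measure constructed
  below has this form: two layers with Bernoulli weights in the duality and in the worst case, \<open>K\<close> uniform
  layers in the robust problem.
\<close>
definition layered :: "'k pmf \<Rightarrow> ('k \<Rightarrow> nat \<Rightarrow> 'a) \<Rightarrow> 'a measure" where
  "layered Q \<xi> = distr (measure_pmf (pair_pmf (pmf_of_set {1..N}) Q)) borel (\<lambda>(i, k). \<xi> k i)"

lemma avg_mono: "(\<And>i. i \<in> {1..N} \<Longrightarrow> f i \<le> g i) \<Longrightarrow> avg f \<le> avg g"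
  unfolding avg_def by (intro mult_left_mono sum_mono) auto

lemma avg_add: "avg (\<lambda>i. f i + g i) = avg f + avg g"
  by (simp add: avg_def sum.distrib distrib_left add_divide_distrib)

lemma avg_diff: "avg (\<lambda>i. f i - g i) = avg f - avg g"
  by (simp add: avg_def sum_subtractf right_diff_distrib diff_divide_distrib)

lemma avg_cmult: "avg (\<lambda>i. c * f i) = c * avg f"
  by (simp add: avg_def sum_distrib_left[symmetric])

lemma avg_const: "avg (\<lambda>i. c) = c"
  using N by (simp add: avg_def)

lemma avg_cong: "(\<And>i. i \<in> {1..N} \<Longrightarrow> f i = g i) \<Longrightarrow> avg f = avg g"
  by (simp add: avg_def)

lemma avg_ge_point:
  assumes "i \<in> {1..N}" and "\<And>i. i \<in> {1..N} \<Longrightarrow> 0 \<le> f i"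
  shows "f i \<le> real N * avg f"
proof -
  have "f i \<le> (\<Sum>i=1..N. f i)" using assms by (intro member_le_sum) auto
  then show ?thesis using N by (simp add: avg_def)
qed

lemma cost_nonneg: "0 \<le> cost \<xi>"
  unfolding cost_def avg_def by (intro mult_nonneg_nonneg sum_nonneg) auto

lemma cost_center: "cost x = 0"
  by (simp add: cost_def avg_def)

lemma set_pmf_samples: "set_pmf (pmf_of_set {1..N}) = {1..N}"
  using N by (intro set_pmf_of_set) auto

lemma measurable_fst_borel: "(fst :: 'a \<times> 'a \<Rightarrow> 'a) \<in> borel_measurable borel"
  by (intro borel_measurable_continuous_onI continuous_intros)

lemma measurable_snd_borel: "(snd :: 'a \<times> 'a \<Rightarrow> 'a) \<in> borel_measurable borel"
  by (intro borel_measurable_continuous_onI continuous_intros)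

lemma feasibleI:
  assumes "\<mu> \<in> borel_prob" "\<gamma> \<in> couplings \<mu> \<nu>"
    and "(\<integral>\<^sup>+ z. ennreal (dist (fst z) (snd z) powr p) \<partial>\<gamma>) \<le> ennreal (\<theta> powr p)"
  shows "\<mu> \<in> feasible p \<theta> \<nu>"
proof -
  let ?c = "transport_cost p \<mu> \<nu>"
  have c: "?c \<le> ennreal (\<theta> powr p)"
    unfolding transport_cost_def by (rule INF_lower2[of \<gamma>]) (use assms in auto)
  then have fin: "?c \<noteq> \<infinity>" using le_less_trans[OF c ennreal_less_top] by simp
  have "enn2real ?c \<le> \<theta> powr p" using c by (simp add: enn2real_leI)
  then have "enn2real ?c powr (1/p) \<le> (\<theta> powr p) powr (1/p)"
    using p by (intro powr_mono2) auto
  also have "\<dots> = \<theta>" using p theta by (simp add: powr_powr)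
  finally show ?thesis using assms(1) fin
    by (simp add: feasible_def wasserstein_def Let_def ennreal_leI)
qed

text \<open>
  The infimum over couplings is approached but perhaps not attained, whence the \<open>\<epsilon>\<close>.
\<close>
lemma feasible_coupling:
  assumes "\<mu> \<in> feasible p \<theta> \<nu>" and "0 < \<epsilon>"
  obtains \<gamma> where "\<gamma> \<in> couplings \<mu> \<nu>"
    and "(\<integral>\<^sup>+ z. ennreal (dist (fst z) (snd z) powr p) \<partial>\<gamma>) \<le> ennreal (\<theta> powr p + \<epsilon>)"
proof -
  let ?c = "transport_cost p \<mu> \<nu>"
  have W: "wasserstein p \<mu> \<nu> \<le> ennreal \<theta>" using assms by (simp add: feasible_def)
  have fin: "?c \<noteq> \<infinity>"
  proof
    assume "?c = \<infinity>"
    then show False using W by (simp add: wasserstein_def top_unique)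
  qed
  have "enn2real ?c powr (1/p) \<le> \<theta>"
    using W fin theta by (simp add: wasserstein_def Let_def)
  then have "(enn2real ?c powr (1/p)) powr p \<le> \<theta> powr p"
    using p by (intro powr_mono2) auto
  then have "enn2real ?c \<le> \<theta> powr p" using p by (simp add: powr_powr)
  then have "?c \<le> ennreal (\<theta> powr p)"
    using fin by (metis ennreal_enn2real_if ennreal_leI infinity_ennreal_def)
  also have "\<dots> < ennreal (\<theta> powr p + \<epsilon>)"
    using assms(2) by (intro ennreal_lessI) (auto intro: add_nonneg_pos)
  finally show ?thesis
    using that unfolding transport_cost_def INF_less_iff by (auto intro: less_imp_le)
qed

text \<open>
  Pairing \<open>\<xi> k i\<close> with the sample \<open>x i\<close> that it replaces gives a coupling with \<open>\<nu>\<close>, whose cost is the mean of the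
  costs of the layers.
\<close>
lemma layered_feasible:
  assumes fin: "finite (set_pmf Q)"
    and le: "measure_pmf.expectation Q (\<lambda>k. cost (\<xi> k)) \<le> \<theta> powr p"
  shows "layered Q \<xi> \<in> feasible p \<theta> \<nu>"
proof -
  let ?P = "pair_pmf (pmf_of_set {1..N}) Q"
  let ?\<gamma> = "distr (measure_pmf ?P) borel (\<lambda>(i, k). (\<xi> k i, x i))"
  have finP: "finite (set_pmf ?P)" using fin unfolding set_pair_pmf set_pmf_samples by simp
  have prob: "?\<gamma> \<in> borel_prob" "layered Q \<xi> \<in> borel_prob"
    unfolding layered_def borel_prob_def
    by (auto intro!: prob_space.prob_space_distr prob_space_measure_pmf)
  have "distr ?\<gamma> borel fst = layered Q \<xi>"
    unfolding layered_def
    by (subst distr_distr) (auto simp: measurable_fst_borel comp_def case_prod_unfold)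
  moreover have "distr ?\<gamma> borel snd = \<nu>"
  proof -
    have "distr ?\<gamma> borel snd = distr (measure_pmf ?P) borel (x \<circ> fst)"
      by (subst distr_distr) (auto simp: measurable_snd_borel comp_def case_prod_unfold)
    also have "\<dots> = distr (distr (measure_pmf ?P) (count_space UNIV) fst) borel x"
      by (subst distr_distr) auto
    also have "\<dots> = distr (measure_pmf (map_pmf fst ?P)) borel x"
      by (simp add: map_pmf_rep_eq)
    finally show ?thesis by (simp add: map_fst_pair_pmf nu)
  qed
  ultimately have coup: "?\<gamma> \<in> couplings (layered Q \<xi>) \<nu>"
    using prob by (simp add: couplings_def)
  have "(\<integral>\<^sup>+ z. ennreal (dist (fst z) (snd z) powr p) \<partial>?\<gamma>)
      = (\<integral>\<^sup>+ j. ennreal ((\<lambda>(i, k). dist (\<xi> k i) (x i) powr p) j) \<partial>measure_pmf ?P)"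
    by (subst nn_integral_pmf_distr[OF finP]) (auto simp: split_beta)
  also have "\<dots> = ennreal (measure_pmf.expectation ?P (\<lambda>(i, k). dist (\<xi> k i) (x i) powr p))"
    by (rule nn_integral_eq_integral) (auto intro: integrable_measure_pmf_finite[OF finP])
  also have "measure_pmf.expectation ?P (\<lambda>(i, k). dist (\<xi> k i) (x i) powr p)
      = measure_pmf.expectation Q (\<lambda>k. cost (\<xi> k))"
    by (subst expectation_pmf_of_set_pair[OF N fin]) (simp add: cost_def avg_def)
  finally show ?thesis
    using le by (intro feasibleI[OF prob(2) coup]) (simp add: ennreal_leI)
qed

lemma layered_ext_integral:
  assumes fin: "finite (set_pmf Q)"
  shows "ext_integral (layered Q \<xi>) (\<lambda>v. ereal (\<Psi> v))
    = ereal (measure_pmf.expectation Q (\<lambda>k. payoff (\<xi> k)))"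
proof -
  let ?P = "pair_pmf (pmf_of_set {1..N}) Q"
  have finP: "finite (set_pmf ?P)" using fin unfolding set_pair_pmf set_pmf_samples by simp
  have "ext_integral (layered Q \<xi>) (\<lambda>v. ereal (\<Psi> v))
      = ereal (measure_pmf.expectation ?P (\<lambda>(i, k). \<Psi> (\<xi> k i)))"
    unfolding layered_def ext_integral_pmf_distr[OF finP]
    by (rule ext_integral_pmf_real[OF finP]) (simp split: prod.split)
  also have "measure_pmf.expectation ?P (\<lambda>(i, k). \<Psi> (\<xi> k i)) = measure_pmf.expectation Q (\<lambda>k. payoff (\<xi> k))"
    by (subst expectation_pmf_of_set_pair[OF N fin]) (simp add: payoff_def avg_def)
  finally show ?thesis .
qed

lemma layered_le_primal:
  assumes "finite (set_pmf Q)"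
    and "measure_pmf.expectation Q (\<lambda>k. cost (\<xi> k)) \<le> \<theta> powr p"
  shows "ereal (measure_pmf.expectation Q (\<lambda>k. payoff (\<xi> k))) \<le> primal_value p \<theta> \<nu> \<Psi>"
  unfolding primal_value_def layered_ext_integral[OF assms(1), symmetric]
  by (rule SUP_upper[OF layered_feasible[OF assms]])

lemma measure_layered:
  assumes fin: "finite (set_pmf Q)" and A: "A \<in> sets borel"
  shows "measure (layered Q \<xi>) A = measure_pmf.expectation Q (\<lambda>k. avg (\<lambda>i. indicator A (\<xi> k i)))"
proof -
  let ?P = "pair_pmf (pmf_of_set {1..N}) Q"
  have "measure (layered Q \<xi>) A = measure (measure_pmf ?P) ((\<lambda>(i, k). \<xi> k i) -` A)"
    unfolding layered_def using A by (simp add: measure_distr)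
  also have "\<dots> = measure_pmf.expectation ?P (indicator ((\<lambda>(i, k). \<xi> k i) -` A))" by simp
  also have "indicator ((\<lambda>(i, k). \<xi> k i) -` A) = (\<lambda>(i, k). indicator A (\<xi> k i) :: real)"
    by (auto simp: indicator_def)
  also have "measure_pmf.expectation ?P \<dots> = measure_pmf.expectation Q (\<lambda>k. avg (\<lambda>i. indicator A (\<xi> k i)))"
    by (subst expectation_pmf_of_set_pair[OF N fin]) (simp add: avg_def)
  finally show ?thesis .
qed

section \<open>The dual objective of an empirical measure\<close>

text \<open>
  The real value of \<open>\<Phi>\<close>, meaningful only where \<open>\<Phi>\<close> is finite.
\<close>
definition phi :: "real \<Rightarrow> 'a \<Rightarrow> real" where
  "phi lam \<zeta> = real_of_ereal (Phi p \<Psi> lam \<zeta>)"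

definition Phi_finite :: "real \<Rightarrow> bool" where
  "Phi_finite lam \<longleftrightarrow> (\<forall>i\<in>{1..N}. Phi p \<Psi> lam (x i) > -\<infinity>)"

lemma Phi_le: "Phi p \<Psi> lam \<zeta> \<le> ereal (lam * dist \<xi> \<zeta> powr p - \<Psi> \<xi>)"
  unfolding Phi_def by (rule INF_lower) auto

lemma Phi_less_PInf: "Phi p \<Psi> lam \<zeta> < \<infinity>"
  using Phi_le[of lam \<zeta> \<zeta>] by auto

lemma Phi_eq_phi:
  assumes "Phi_finite lam" "i \<in> {1..N}"
  shows "Phi p \<Psi> lam (x i) = ereal (phi lam (x i))"
  using assms Phi_less_PInf[of lam "x i"] by (auto simp: phi_def Phi_finite_def ereal_real)

lemma phi_le:
  assumes "Phi_finite lam" "i \<in> {1..N}"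
  shows "phi lam (x i) \<le> lam * dist \<xi> (x i) powr p - \<Psi> \<xi>"
  using Phi_le[of lam "x i" \<xi>] Phi_eq_phi[OF assms] by simp

lemma ext_integral_Phi:
  "ext_integral \<nu> (Phi p \<Psi> lam) =
    (if Phi_finite lam then ereal (avg (\<lambda>i. phi lam (x i))) else -\<infinity>)"
proof -
  let ?P = "pmf_of_set {1..N}"
  have fin: "finite (set_pmf ?P)" unfolding set_pmf_samples by simp
  show ?thesis
  proof (cases "Phi_finite lam")
    case True
    have "ext_integral \<nu> (Phi p \<Psi> lam) = ereal (measure_pmf.expectation ?P (\<lambda>i. phi lam (x i)))"
      unfolding nu ext_integral_pmf_distr[OF fin]
      by (rule ext_integral_pmf_real[OF fin]) (use Phi_eq_phi[OF True] in \<open>auto simp: set_pmf_samples\<close>)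
    also have "measure_pmf.expectation ?P (\<lambda>i. phi lam (x i)) = avg (\<lambda>i. phi lam (x i))"
      using N by (subst integral_pmf_of_set) (auto simp: avg_def)
    finally show ?thesis using True by simp
  next
    case False
    then obtain i where "i \<in> {1..N}" "Phi p \<Psi> lam (x i) = -\<infinity>"
      by (auto simp: Phi_finite_def)
    then show ?thesis using False Phi_less_PInf
      unfolding nu ext_integral_pmf_distr[OF fin]
      by (subst ext_integral_pmf_MInf[OF fin, of _ i]) (auto simp: set_pmf_samples)
  qed
qed

lemma dual_objective_eq:
  "dual_objective p \<theta> \<nu> \<Psi> lam =
    (if Phi_finite lam then ereal (lam * \<theta> powr p - avg (\<lambda>i. phi lam (x i))) else \<infinity>)"
  by (simp add: dual_objective_def ext_integral_Phi)

text \<open>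
  In the infinite case both sides are \<open>\<infinity>\<close>: one summand is \<open>-\<infinity>\<close> and none is \<open>\<infinity>\<close>, so the extended sum is
  \<open>-\<infinity>\<close>.
\<close>
lemma dual_objective_explicit:
  "dual_objective p \<theta> \<nu> \<Psi> lam = ereal (lam * \<theta> powr p) -
          ereal (1 / real N) * (\<Sum>i=1..N. INF \<xi>. ereal (lam * dist \<xi> (x i) powr p - \<Psi> \<xi>))"
proof -
  have "ereal (1 / real N) * (\<Sum>i=1..N. Phi p \<Psi> lam (x i)) = ext_integral \<nu> (Phi p \<Psi> lam)"
  proof (cases "Phi_finite lam")
    case True
    have "(\<Sum>i=1..N. Phi p \<Psi> lam (x i)) = (\<Sum>i=1..N. ereal (phi lam (x i)))"
      using Phi_eq_phi[OF True] by (intro sum.cong) auto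
    with True show ?thesis by (simp add: ext_integral_Phi avg_def)
  next
    case False
    then obtain i where i: "i \<in> {1..N}" "Phi p \<Psi> lam (x i) = -\<infinity>"
      by (auto simp: Phi_finite_def)
    have "(\<Sum>i\<in>{1..N} - {i}. Phi p \<Psi> lam (x i)) \<noteq> \<infinity>"
      using Phi_less_PInf by (subst sum_Pinfty) (auto simp: less_le)
    then have "(\<Sum>i=1..N. Phi p \<Psi> lam (x i)) = -\<infinity>"
      using i by (subst sum.remove[of _ i]) auto
    with False show ?thesis using N by (simp add: ext_integral_Phi)
  qed
  then show ?thesis by (simp add: dual_objective_def Phi_def)
qed

section \<open>Couplings with the empirical measure\<close>

definition centers :: "'a set" where
  "centers = x ` {1..N}"

lemma finite_centers [simp]: "finite centers"
  by (simp add: centers_def)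

lemma center_in [simp]: "i \<in> {1..N} \<Longrightarrow> x i \<in> centers"
  by (auto simp: centers_def)

definition section_integrable :: "'a measure \<Rightarrow> ('a \<Rightarrow> 'a \<Rightarrow> real) \<Rightarrow> bool" where
  "section_integrable \<mu> F \<longleftrightarrow> (\<forall>\<zeta>\<in>centers. integrable \<mu> (\<lambda>\<xi>. F \<xi> \<zeta>))"

text \<open>
  For a coupling with \<open>\<nu>\<close> this is the mean of \<open>F (fst z) (snd z)\<close>, because the second coordinate
  lies almost surely in the finite set of samples. Written as a sum over that set, it needs only
  measurability of the sections \<open>F _ \<zeta>\<close>, not joint measurability.
\<close>
definition coupling_mean :: "('a \<times> 'a) measure \<Rightarrow> ('a \<Rightarrow> 'a \<Rightarrow> real) \<Rightarrow> real" where
  "coupling_mean \<gamma> F = (\<integral>z. (\<Sum>\<zeta>\<in>centers. indicator {\<zeta>} (snd z) * F (fst z) \<zeta>) \<partial>\<gamma>)"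

lemma section_integrable_add: "section_integrable \<mu> F \<Longrightarrow> section_integrable \<mu> G \<Longrightarrow> section_integrable \<mu> (\<lambda>\<xi> \<zeta>. F \<xi> \<zeta> + G \<xi> \<zeta>)"
  by (simp add: section_integrable_def)

lemma section_integrable_diff: "section_integrable \<mu> F \<Longrightarrow> section_integrable \<mu> G \<Longrightarrow> section_integrable \<mu> (\<lambda>\<xi> \<zeta>. F \<xi> \<zeta> - G \<xi> \<zeta>)"
  by (simp add: section_integrable_def)

lemma section_integrable_cmult: "section_integrable \<mu> F \<Longrightarrow> section_integrable \<mu> (\<lambda>\<xi> \<zeta>. c * F \<xi> \<zeta>)"
  by (simp add: section_integrable_def)

lemma section_integrable_center: "prob_space \<mu> \<Longrightarrow> section_integrable \<mu> (\<lambda>\<xi> \<zeta>. g \<zeta>)"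
  by (simp add: section_integrable_def finite_measure.integrable_const prob_space.finite_measure)

lemma section_integrable_fst: "integrable \<mu> f \<Longrightarrow> section_integrable \<mu> (\<lambda>\<xi> \<zeta>. f \<xi>)"
  by (simp add: section_integrable_def)

context
  fixes \<mu> :: "'a measure" and \<gamma> :: "('a \<times> 'a) measure"
  assumes \<gamma>: "\<gamma> \<in> couplings \<mu> \<nu>"
begin

lemma coupling_prob: "prob_space \<gamma>"
  and coupling_sets: "sets \<gamma> = sets borel"
  and coupling_fst: "distr \<gamma> borel fst = \<mu>"
  and coupling_snd: "distr \<gamma> borel snd = \<nu>"
  using \<gamma> by (auto simp: couplings_def borel_prob_def)

lemma meas_fst: "fst \<in> \<gamma> \<rightarrow>\<^sub>M borel" and meas_snd: "snd \<in> \<gamma> \<rightarrow>\<^sub>M borel"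
  using measurable_fst_borel measurable_snd_borel measurable_cong_sets[OF coupling_sets refl] by auto

lemma coupling_marginal_prob: "prob_space \<mu>"
  using prob_space.prob_space_distr[OF coupling_prob meas_fst] coupling_fst by simp

lemma coupling_marginal_sets: "sets \<mu> = sets borel"
  using coupling_fst by auto

lemma coupling_centers: "AE z in \<gamma>. snd z \<in> centers"
proof -
  have "AE v in distr \<gamma> borel snd. v \<in> centers"
    unfolding coupling_snd nu centers_def
    using pmf_distr_AE[of "pmf_of_set {1..N}" x] unfolding set_pmf_samples by auto
  moreover have "centers \<in> sets borel"
    by (intro borel_closed finite_imp_closed) simp
  ultimately show ?thesis by (subst (asm) AE_distr_iff[OF meas_snd]) auto
qed

lemma coupling_integrable_fst:
  assumes "integrable \<mu> (f :: 'a \<Rightarrow> real)"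
  shows "integrable \<gamma> (\<lambda>z. f (fst z))" and "(\<integral>z. f (fst z) \<partial>\<gamma>) = (\<integral>\<xi>. f \<xi> \<partial>\<mu>)"
proof -
  have f: "f \<in> borel_measurable borel"
    using assms measurable_cong_sets[OF coupling_marginal_sets refl] by auto
  show "integrable \<gamma> (\<lambda>z. f (fst z))"
    using assms integrable_distr_eq[OF meas_fst f] coupling_fst by simp
  show "(\<integral>z. f (fst z) \<partial>\<gamma>) = (\<integral>\<xi>. f \<xi> \<partial>\<mu>)"
    using integral_distr[OF meas_fst f] coupling_fst by simp
qed

lemma coupling_mean_term_integrable:
  assumes "section_integrable \<mu> F" "\<zeta> \<in> centers"
  shows "integrable \<gamma> (\<lambda>z. indicator {\<zeta>} (snd z) * F (fst z) \<zeta>)"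
proof -
  have int: "integrable \<gamma> (\<lambda>z. F (fst z) \<zeta>)"
    using assms by (intro coupling_integrable_fst) (simp add: section_integrable_def)
  have "snd -` {\<zeta>} \<inter> space \<gamma> \<in> sets \<gamma>"
    by (rule measurable_sets[OF meas_snd]) auto
  moreover have "space \<gamma> = UNIV" using sets_eq_imp_space_eq[OF coupling_sets] by simp
  ultimately have "integrable \<gamma> (\<lambda>z. indicator (snd -` {\<zeta>}) z *\<^sub>R F (fst z) \<zeta>)"
    by (intro integrable_mult_indicator int) simp
  then show ?thesis by (simp add: indicator_def vimage_def)
qed

lemma coupling_mean_integrable:
  "section_integrable \<mu> F \<Longrightarrow> integrable \<gamma> (\<lambda>z. \<Sum>\<zeta>\<in>centers. indicator {\<zeta>} (snd z) * F (fst z) \<zeta>)"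
  by (intro Bochner_Integration.integrable_sum coupling_mean_term_integrable)

lemma coupling_mean_add:
  assumes "section_integrable \<mu> F" "section_integrable \<mu> G"
  shows "coupling_mean \<gamma> (\<lambda>\<xi> \<zeta>. F \<xi> \<zeta> + G \<xi> \<zeta>) = coupling_mean \<gamma> F + coupling_mean \<gamma> G"
  unfolding coupling_mean_def using coupling_mean_integrable[OF assms(1)] coupling_mean_integrable[OF assms(2)]
  by (simp add: distrib_left sum.distrib)

lemma coupling_mean_diff:
  assumes "section_integrable \<mu> F" "section_integrable \<mu> G"
  shows "coupling_mean \<gamma> (\<lambda>\<xi> \<zeta>. F \<xi> \<zeta> - G \<xi> \<zeta>) = coupling_mean \<gamma> F - coupling_mean \<gamma> G"
  unfolding coupling_mean_def using coupling_mean_integrable[OF assms(1)] coupling_mean_integrable[OF assms(2)]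
  by (simp add: right_diff_distrib sum_subtractf)

lemma coupling_mean_cmult:
  "coupling_mean \<gamma> (\<lambda>\<xi> \<zeta>. c * F \<xi> \<zeta>) = c * coupling_mean \<gamma> F"
proof -
  have "(\<Sum>\<zeta>\<in>centers. indicator {\<zeta>} (snd z) * (c * F (fst z) \<zeta>))
      = c * (\<Sum>\<zeta>\<in>centers. indicator {\<zeta>} (snd z) * F (fst z) \<zeta>)" for z :: "'a \<times> 'a"
    by (subst sum_distrib_left) (rule sum.cong[OF refl], simp only: mult.left_commute)
  then show ?thesis unfolding coupling_mean_def by simp
qed

text \<open>
  The inequality is only required \<open>\<mu>\<close>-almost everywhere in each section, which allows an objective to be
  replaced by a Borel version.
\<close>
lemma coupling_mean_mono:
  assumes "section_integrable \<mu> F" "section_integrable \<mu> G"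
    and "\<And>\<zeta>. \<zeta> \<in> centers \<Longrightarrow> AE \<xi> in \<mu>. F \<xi> \<zeta> \<le> G \<xi> \<zeta>"
  shows "coupling_mean \<gamma> F \<le> coupling_mean \<gamma> G"
  unfolding coupling_mean_def
proof (rule integral_mono_AE[OF coupling_mean_integrable[OF assms(1)] coupling_mean_integrable[OF assms(2)]])
  have "AE \<xi> in distr \<gamma> borel fst. \<forall>\<zeta>\<in>centers. F \<xi> \<zeta> \<le> G \<xi> \<zeta>"
    unfolding coupling_fst using assms(3) by (simp add: AE_ball_countable countable_finite)
  then have "AE z in \<gamma>. \<forall>\<zeta>\<in>centers. F (fst z) \<zeta> \<le> G (fst z) \<zeta>"
    by (rule AE_distrD[OF meas_fst])
  then show "AE z in \<gamma>. (\<Sum>\<zeta>\<in>centers. indicator {\<zeta>} (snd z) * F (fst z) \<zeta>)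
      \<le> (\<Sum>\<zeta>\<in>centers. indicator {\<zeta>} (snd z) * G (fst z) \<zeta>)"
    by eventually_elim (intro sum_mono mult_left_mono, auto)
qed

lemma coupling_mean_collapse:
  "snd z \<in> centers \<Longrightarrow> (\<Sum>\<zeta>\<in>centers. indicator {\<zeta>} (snd z) * F (fst z) \<zeta>) = (F (fst z) (snd z) :: real)"
proof -
  assume "snd z \<in> centers"
  moreover have "(\<Sum>\<zeta>\<in>centers. indicator {\<zeta>} (snd z) * F (fst z) \<zeta>)
      = (\<Sum>\<zeta>\<in>centers. if \<zeta> = snd z then F (fst z) \<zeta> else 0)"
    by (rule sum.cong) auto
  ultimately show ?thesis by (simp add: sum.delta)
qed

lemma coupling_mean_eq_integral:
  assumes "section_integrable \<mu> F" "(\<lambda>z. F (fst z) (snd z)) \<in> borel_measurable \<gamma>"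
  shows "coupling_mean \<gamma> F = (\<integral>z. F (fst z) (snd z) \<partial>\<gamma>)"
  unfolding coupling_mean_def
proof (rule integral_cong_AE)
  show "AE z in \<gamma>. (\<Sum>\<zeta>\<in>centers. indicator {\<zeta>} (snd z) * F (fst z) \<zeta>) = F (fst z) (snd z)"
    using coupling_centers by eventually_elim (rule coupling_mean_collapse)
qed (use assms coupling_mean_integrable[OF assms(1)] in auto)

lemma coupling_mean_fst:
  assumes "integrable \<mu> f"
  shows "coupling_mean \<gamma> (\<lambda>\<xi> \<zeta>. f \<xi>) = (\<integral>\<xi>. f \<xi> \<partial>\<mu>)"
  using coupling_integrable_fst[OF assms]
  by (subst coupling_mean_eq_integral) (auto intro: section_integrable_fst assms)

lemma coupling_mean_center: "coupling_mean \<gamma> (\<lambda>\<xi> \<zeta>. g \<zeta>) = avg (\<lambda>i. g (x i))"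
proof -
  define h where "h \<zeta> = (if \<zeta> \<in> centers then g \<zeta> else 0)" for \<zeta>
  have h: "h \<in> borel_measurable borel"
    by (rule measurable_discrete_difference[where X="centers" and f="\<lambda>_. 0"])
      (auto simp: h_def countable_finite)
  have "coupling_mean \<gamma> (\<lambda>\<xi> \<zeta>. g \<zeta>) = coupling_mean \<gamma> (\<lambda>\<xi> \<zeta>. h \<zeta>)"
    by (simp add: coupling_mean_def h_def)
  also have "\<dots> = (\<integral>z. h (snd z) \<partial>\<gamma>)"
    using h meas_snd by (intro coupling_mean_eq_integral section_integrable_center coupling_marginal_prob) simp
  also have "\<dots> = (\<integral>\<zeta>. h \<zeta> \<partial>\<nu>)"
    using integral_distr[OF meas_snd h] coupling_snd by simp
  also have "\<dots> = (\<integral>i. h (x i) \<partial>measure_pmf (pmf_of_set {1..N}))"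
    unfolding nu by (rule integral_distr) (auto simp: h)
  also have "\<dots> = avg (\<lambda>i. h (x i))"
    using N by (subst integral_pmf_of_set) (auto simp: avg_def)
  also have "\<dots> = avg (\<lambda>i. g (x i))"
    by (rule avg_cong) (simp add: h_def)
  finally show ?thesis .
qed

text \<open>
  By \<open>(a + b)^p \<le> 2^p (a^p + b^p)\<close>, a finite transport cost to the finitely many samples gives \<open>\<mu>\<close>-integrability
  of the cost to each single sample. This is the domination used later for varying couplings.
\<close>
lemma coupling_moments:
  assumes "(\<integral>\<^sup>+ z. ennreal (dist (fst z) (snd z) powr p) \<partial>\<gamma>) < \<infinity>"
  shows "section_integrable \<mu> (\<lambda>\<xi> \<zeta>. dist \<xi> \<zeta> powr p)"
    and "integrable \<gamma> (\<lambda>z. dist (fst z) (snd z) powr p)"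
proof -
  have meas: "(\<lambda>z. dist (fst z) (snd z) powr p) \<in> borel_measurable \<gamma>"
    using meas_fst meas_snd by measurable
  show int: "integrable \<gamma> (\<lambda>z. dist (fst z) (snd z) powr p)"
    using assms meas by (intro integrableI_nonneg) auto
  show "section_integrable \<mu> (\<lambda>\<xi> \<zeta>. dist \<xi> \<zeta> powr p)"
    unfolding section_integrable_def
  proof
    fix \<zeta> assume \<zeta>: "\<zeta> \<in> centers"
    define M where "M = (\<Sum>\<zeta>'\<in>centers. dist \<zeta>' \<zeta> powr p)"
    have bound: "dist \<xi> \<zeta> powr p \<le> 2 powr p * (dist \<xi> \<zeta>' powr p + M)" if "\<zeta>' \<in> centers" for \<xi> \<zeta>'
    proof -
      define a b where "a = dist \<xi> \<zeta>'" and "b = dist \<zeta>' \<zeta>"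
      have "dist \<xi> \<zeta> \<le> 2 * max a b"
        using dist_triangle[of \<xi> \<zeta> \<zeta>'] by (simp add: a_def b_def)
      then have "dist \<xi> \<zeta> powr p \<le> (2 * max a b) powr p"
        using p by (intro powr_mono2) auto
      also have "\<dots> = 2 powr p * (max a b) powr p"
        by (intro powr_mult)
      also have "(max a b) powr p \<le> a powr p + b powr p"
        by (simp add: max_def)
      also have "b powr p \<le> M"
        unfolding M_def b_def using that by (intro member_le_sum) auto
      finally show ?thesis by (simp add: a_def)
    qed
    have "integrable \<gamma> (\<lambda>z. dist (fst z) \<zeta> powr p)"
    proof (rule Bochner_Integration.integrable_bound)
      show "integrable \<gamma> (\<lambda>z. 2 powr p * (dist (fst z) (snd z) powr p + M))"
        using int coupling_prob by (auto simp: finite_measure.integrable_const prob_space.finite_measure)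
      show "(\<lambda>z. dist (fst z) \<zeta> powr p) \<in> borel_measurable \<gamma>"
        using meas_fst by measurable
      show "AE z in \<gamma>. norm (dist (fst z) \<zeta> powr p) \<le> norm (2 powr p * (dist (fst z) (snd z) powr p + M))"
        using coupling_centers
      proof eventually_elim
        case (elim z)
        have "0 \<le> M" unfolding M_def by (intro sum_nonneg) auto
        then show ?case using bound[OF elim, of "fst z"] by (simp add: abs_mult)
      qed
    qed
    then have "integrable (distr \<gamma> borel fst) (\<lambda>\<xi>. dist \<xi> \<zeta> powr p)"
      by (subst integrable_distr_eq[OF meas_fst]) auto
    then show "integrable \<mu> (\<lambda>\<xi>. dist \<xi> \<zeta> powr p)" by (simp add: coupling_fst)
  qed
qed

lemma coupling_mean_cost:
  assumes "(\<integral>\<^sup>+ z. ennreal (dist (fst z) (snd z) powr p) \<partial>\<gamma>) \<le> ennreal c" and "0 \<le> c"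
  shows "coupling_mean \<gamma> (\<lambda>\<xi> \<zeta>. dist \<xi> \<zeta> powr p) \<le> c"
proof -
  have fin: "(\<integral>\<^sup>+ z. ennreal (dist (fst z) (snd z) powr p) \<partial>\<gamma>) < \<infinity>"
    using le_less_trans[OF assms(1) ennreal_less_top] by simp
  note int = coupling_moments[OF fin]
  have "coupling_mean \<gamma> (\<lambda>\<xi> \<zeta>. dist \<xi> \<zeta> powr p) = (\<integral>z. dist (fst z) (snd z) powr p \<partial>\<gamma>)"
    using int(2) by (intro coupling_mean_eq_integral int(1)) auto
  moreover have "ennreal (\<integral>z. dist (fst z) (snd z) powr p \<partial>\<gamma>)
      = (\<integral>\<^sup>+ z. ennreal (dist (fst z) (snd z) powr p) \<partial>\<gamma>)"
    by (rule nn_integral_eq_integral[symmetric, OF int(2)]) auto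
  ultimately show ?thesis using assms by (metis ennreal_le_iff)
qed

end

lemma feasible_coupling_mean:
  assumes "\<mu> \<in> feasible p \<theta> \<nu>" and "0 < \<epsilon>"
  obtains \<gamma> where "\<gamma> \<in> couplings \<mu> \<nu>" and "section_integrable \<mu> (\<lambda>\<xi> \<zeta>. dist \<xi> \<zeta> powr p)"
    and "coupling_mean \<gamma> (\<lambda>\<xi> \<zeta>. dist \<xi> \<zeta> powr p) \<le> \<theta> powr p + \<epsilon>"
proof -
  obtain \<gamma> where g: "\<gamma> \<in> couplings \<mu> \<nu>"
    "(\<integral>\<^sup>+ z. ennreal (dist (fst z) (snd z) powr p) \<partial>\<gamma>) \<le> ennreal (\<theta> powr p + \<epsilon>)"
    by (rule feasible_coupling[OF assms])
  have "(\<integral>\<^sup>+ z. ennreal (dist (fst z) (snd z) powr p) \<partial>\<gamma>) < \<infinity>"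
    using le_less_trans[OF g(2) ennreal_less_top] by simp
  then show ?thesis
    using that[OF g(1) coupling_moments(1)[OF g(1)] coupling_mean_cost[OF g]] assms(2) by auto
qed

section \<open>Weak duality\<close>

text \<open>
  Integrate \<open>\<Psi> \<xi> \<le> \<lambda> d(\<xi>, \<zeta>)^p - \<Phi>(\<lambda>, \<zeta>)\<close> over a coupling of cost at most \<open>\<theta>^p + \<epsilon>\<close>, after passing to a
  Borel version of \<open>\<Psi>\<close>.
\<close>
lemma weak_duality_integrable:
  assumes "\<mu> \<in> feasible p \<theta> \<nu>" and "Phi_finite lam" and "integrable (completion \<mu>) \<Psi>"
    and "0 \<le> lam"
  shows "integral\<^sup>L (completion \<mu>) \<Psi> \<le> lam * \<theta> powr p - avg (\<lambda>i. phi lam (x i))"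
proof (rule field_le_epsilon)
  fix e :: real assume "0 < e"
  define \<epsilon> where "\<epsilon> = e / (lam + 1)"
  have \<epsilon>: "0 < \<epsilon>" using \<open>0 < e\<close> assms(4) by (simp add: \<epsilon>_def)
  have "lam * \<epsilon> \<le> e" using \<open>0 < e\<close> assms(4) by (simp add: \<epsilon>_def field_simps)
  obtain \<gamma> where g: "\<gamma> \<in> couplings \<mu> \<nu>" and b: "section_integrable \<mu> (\<lambda>\<xi> \<zeta>. dist \<xi> \<zeta> powr p)"
    and c: "coupling_mean \<gamma> (\<lambda>\<xi> \<zeta>. dist \<xi> \<zeta> powr p) \<le> \<theta> powr p + \<epsilon>"
    by (rule feasible_coupling_mean[OF assms(1) \<epsilon>])
  obtain \<Psi>' where \<Psi>': "\<Psi>' \<in> borel_measurable \<mu>" "AE \<xi> in \<mu>. \<Psi> \<xi> = \<Psi>' \<xi>"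
    using completion_ex_borel_measurable_real[OF borel_measurable_integrable[OF assms(3)]] by auto
  have eq: "integral\<^sup>L (completion \<mu>) \<Psi> = integral\<^sup>L (completion \<mu>) \<Psi>'"
    using AE_completion[OF \<Psi>'(2)] borel_measurable_integrable[OF assms(3)] measurable_completion[OF \<Psi>'(1)]
    by (intro integral_cong_AE) auto
  have "integrable (completion \<mu>) \<Psi>'"
    using AE_completion[OF \<Psi>'(2)] assms(3) measurable_completion[OF \<Psi>'(1)]
    by (subst integrable_cong_AE[symmetric]) auto
  then have int: "integrable \<mu> \<Psi>'" using integrable_completion[OF \<Psi>'(1)] by simp
  have pr: "prob_space \<mu>" using assms(1) by (simp add: feasible_def borel_prob_def)
  have "integral\<^sup>L (completion \<mu>) \<Psi> = coupling_mean \<gamma> (\<lambda>\<xi> \<zeta>. \<Psi>' \<xi>)"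
    using eq integral_completion[OF \<Psi>'(1)] coupling_mean_fst[OF g int] by simp
  also have "\<dots> \<le> coupling_mean \<gamma> (\<lambda>\<xi> \<zeta>. lam * dist \<xi> \<zeta> powr p - phi lam \<zeta>)"
  proof (rule coupling_mean_mono[OF g])
    show "AE \<xi> in \<mu>. \<Psi>' \<xi> \<le> lam * dist \<xi> \<zeta> powr p - phi lam \<zeta>" if \<zeta>: "\<zeta> \<in> centers" for \<zeta>
      using \<Psi>'(2)
    proof eventually_elim
      case (elim \<xi>)
      obtain i where "i \<in> {1..N}" "\<zeta> = x i" using \<zeta> by (auto simp: centers_def)
      then show ?case using phi_le[OF assms(2), of i \<xi>] elim by simp
    qed
  qed (intro section_integrable_diff section_integrable_cmult b section_integrable_center pr section_integrable_fst int)+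
  also have "\<dots> = lam * coupling_mean \<gamma> (\<lambda>\<xi> \<zeta>. dist \<xi> \<zeta> powr p) - avg (\<lambda>i. phi lam (x i))"
    by (simp add: coupling_mean_diff[OF g section_integrable_cmult[OF b] section_integrable_center[OF pr]]
        coupling_mean_cmult[OF g] coupling_mean_center[OF g])
  also have "\<dots> \<le> lam * (\<theta> powr p + \<epsilon>) - avg (\<lambda>i. phi lam (x i))"
    using c assms(4) by (intro diff_right_mono mult_left_mono)
  finally show "integral\<^sup>L (completion \<mu>) \<Psi> \<le> lam * \<theta> powr p - avg (\<lambda>i. phi lam (x i)) + e"
    using \<open>lam * \<epsilon> \<le> e\<close> by (simp add: distrib_left)
qed

text \<open>
  The bound \<open>\<Psi> \<xi> \<le> \<lambda> d(\<xi>, x 1)^p - \<Phi>(\<lambda>, x 1)\<close> makes the positive part of \<open>\<Psi>\<close> integrable, so that only integrable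
  \<open>\<Psi>\<close> remain.
\<close>
lemma weak_duality:
  assumes "\<mu> \<in> feasible p \<theta> \<nu>" and "0 \<le> lam"
  shows "ext_integral \<mu> (\<lambda>\<xi>. ereal (\<Psi> \<xi>)) \<le> dual_objective p \<theta> \<nu> \<Psi> lam"
proof (cases "Phi_finite lam")
  case True
  have pr: "prob_space \<mu>" using assms(1) by (simp add: feasible_def borel_prob_def)
  obtain \<gamma> where g: "\<gamma> \<in> couplings \<mu> \<nu>" and b: "section_integrable \<mu> (\<lambda>\<xi> \<zeta>. dist \<xi> \<zeta> powr p)"
    by (rule feasible_coupling_mean[OF assms(1) zero_less_one])
  let ?u = "\<lambda>\<xi>. lam * dist \<xi> (x 1) powr p + \<bar>phi lam (x 1)\<bar>"
  have "integrable \<mu> (\<lambda>\<xi>. dist \<xi> (x 1) powr p)"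
    using b N by (simp add: section_integrable_def)
  then have "integrable \<mu> ?u"
    using pr by (simp add: finite_measure.integrable_const prob_space.finite_measure)
  then have "(\<integral>\<^sup>+ \<xi>. ennreal (?u \<xi>) \<partial>\<mu>) < \<infinity>"
    using assms(2) by (subst nn_integral_eq_integral) auto
  moreover have "(\<integral>\<^sup>+ \<xi>. ennreal (\<Psi> \<xi>) \<partial>\<mu>) \<le> (\<integral>\<^sup>+ \<xi>. ennreal (?u \<xi>) \<partial>\<mu>)"
  proof (intro nn_integral_mono ennreal_leI)
    fix \<xi> show "\<Psi> \<xi> \<le> ?u \<xi>" using phi_le[OF True, of 1 \<xi>] N by simp
  qed
  ultimately have "integrable (completion \<mu>) \<Psi> \<or> ext_integral \<mu> (\<lambda>\<xi>. ereal (\<Psi> \<xi>)) = -\<infinity>"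
    by (intro integrable_or_ext_integral_MInf) (rule le_less_trans)
  then show ?thesis
    using weak_duality_integrable[OF assms(1) True _ assms(2)] True
    by (auto simp: ext_integral_eq_integral dual_objective_eq)
qed (simp add: dual_objective_eq)

lemma primal_le_dual: "primal_value p \<theta> \<nu> \<Psi> \<le> dual_value p \<theta> \<nu> \<Psi>"
  unfolding primal_value_def dual_value_def using weak_duality by (intro SUP_least INF_greatest) auto

section \<open>Strong duality\<close>

lemma mixture_le_primal:
  assumes "0 \<le> \<alpha>" "\<alpha> \<le> 1" and "\<alpha> * cost \<xi> + (1 - \<alpha>) * cost \<eta> \<le> \<theta> powr p"
  shows "ereal (\<alpha> * payoff \<xi> + (1 - \<alpha>) * payoff \<eta>) \<le> primal_value p \<theta> \<nu> \<Psi>"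
  using layered_le_primal[of "bernoulli_pmf \<alpha>" "\<lambda>k. if k then \<xi> else \<eta>"] assms
  by (simp add: mult.commute finite_subset[OF subset_UNIV])

definition mixture_value :: ereal where
  "mixture_value = Sup {ereal (\<alpha> * payoff \<xi> + (1 - \<alpha>) * payoff \<eta>) | \<alpha> \<xi> \<eta>.
     0 \<le> \<alpha> \<and> \<alpha> \<le> 1 \<and> \<alpha> * cost \<xi> + (1 - \<alpha>) * cost \<eta> \<le> \<theta> powr p}"

lemma mixture_value_upper:
  "0 \<le> \<alpha> \<Longrightarrow> \<alpha> \<le> 1 \<Longrightarrow> \<alpha> * cost \<xi> + (1 - \<alpha>) * cost \<eta> \<le> \<theta> powr p \<Longrightarrow>
    ereal (\<alpha> * payoff \<xi> + (1 - \<alpha>) * payoff \<eta>) \<le> mixture_value"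
  unfolding mixture_value_def by (rule Sup_upper) blast

lemma mixture_value_le_primal: "mixture_value \<le> primal_value p \<theta> \<nu> \<Psi>"
  unfolding mixture_value_def by (rule Sup_least) (auto intro: mixture_le_primal)

lemma payoff_le_mixture_value: "cost \<xi> \<le> \<theta> powr p \<Longrightarrow> ereal (payoff \<xi>) \<le> mixture_value"
  using mixture_value_upper[of 1 \<xi> \<xi>] by simp

lemma near_minimizers:
  assumes "Phi_finite lam" "0 < \<epsilon>"
  obtains \<xi> where "\<And>i. i \<in> {1..N} \<Longrightarrow> lam * dist (\<xi> i) (x i) powr p - \<Psi> (\<xi> i) \<le> phi lam (x i) + \<epsilon>"
proof -
  have "\<exists>y. lam * dist y (x i) powr p - \<Psi> y \<le> phi lam (x i) + \<epsilon>" if "i \<in> {1..N}" for i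
  proof -
    have "Phi p \<Psi> lam (x i) < ereal (phi lam (x i) + \<epsilon>)"
      using Phi_eq_phi[OF assms(1) that] assms(2) by simp
    then show ?thesis unfolding Phi_def INF_less_iff by (auto intro: less_imp_le)
  qed
  then show ?thesis using that by metis
qed

lemma avg_slack:
  "avg (\<lambda>i. lam * dist (\<xi> i) (x i) powr p - \<Psi> (\<xi> i)) = lam * cost \<xi> - payoff \<xi>"
  by (simp add: avg_diff avg_cmult cost_def payoff_def)

lemma payoff_le:
  assumes "Phi_finite lam"
  shows "avg (\<lambda>i. phi lam (x i)) \<le> lam * cost \<xi> - payoff \<xi>"
  unfolding avg_slack[symmetric] by (intro avg_mono phi_le assms)

text \<open>
  \<open>\<lambda>\<close> is the largest slope from \<open>(\<theta>^p, V)\<close> to configurations over budget (or \<open>0\<close>). It is at most each slope coming from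
  configurations under budget, since the mixture whose cost is exactly \<open>\<theta>^p\<close> has payoff at most \<open>V\<close>. The
  budget is positive, so \<open>x\<close> itself is strictly under budget and bounds the slopes.
\<close>
lemma supporting_slope:
  assumes V: "mixture_value = ereal V"
  obtains lam where "0 \<le> lam" and "\<And>\<xi>. payoff \<xi> - lam * cost \<xi> \<le> V - lam * \<theta> powr p"
proof -
  define t where "t = \<theta> powr p"
  have t: "0 < t" using theta by (simp add: t_def)
  have mix: "\<alpha> * payoff \<xi> + (1 - \<alpha>) * payoff \<eta> \<le> V"
    if "0 \<le> \<alpha>" "\<alpha> \<le> 1" "\<alpha> * cost \<xi> + (1 - \<alpha>) * cost \<eta> \<le> t" for \<alpha> \<xi> \<eta>
    using mixture_value_upper[of \<alpha> \<xi> \<eta>] that V by (simp add: t_def)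
  have single: "payoff \<eta> \<le> V" if "cost \<eta> \<le> t" for \<eta>
    using mix[of 1 \<eta> \<eta>] that by simp
  define S where "S = insert 0 {(payoff \<xi> - V) / (cost \<xi> - t) | \<xi>. t < cost \<xi>}"
  have bound: "r \<le> (V - payoff \<eta>) / (t - cost \<eta>)" if rS: "r \<in> S" and less: "cost \<eta> < t" for r \<eta>
  proof (cases "r = 0")
    case True
    then show ?thesis using single[of \<eta>] less by simp
  next
    case False
    then obtain \<xi> where \<xi>: "t < cost \<xi>" "r = (payoff \<xi> - V) / (cost \<xi> - t)"
      using rS by (auto simp: S_def)
    \<comment> \<open>the weight for which the mixture has cost exactly \<open>t\<close>\<close>
    define w \<alpha> where "w = cost \<xi> - cost \<eta>" and "\<alpha> = (t - cost \<eta>) / w"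
    have w: "0 < w" using \<xi>(1) less by (simp add: w_def)
    have \<alpha>: "0 \<le> \<alpha>" "\<alpha> \<le> 1" and wa: "w * \<alpha> = t - cost \<eta>"
      using w \<xi>(1) less by (auto simp: \<alpha>_def w_def field_simps)
    have wb: "w * (1 - \<alpha>) = cost \<xi> - t"
      using wa by (simp add: w_def right_diff_distrib)
    have "\<alpha> * cost \<xi> + (1 - \<alpha>) * cost \<eta> = cost \<eta> + w * \<alpha>"
      by (simp add: w_def algebra_simps)
    then have "\<alpha> * payoff \<xi> + (1 - \<alpha>) * payoff \<eta> \<le> V"
      using wa by (intro mix \<alpha>) simp
    then have "w * (\<alpha> * payoff \<xi> + (1 - \<alpha>) * payoff \<eta>) \<le> w * V"
      using w by (intro mult_left_mono) auto
    also have "w * (\<alpha> * payoff \<xi> + (1 - \<alpha>) * payoff \<eta>) = w * \<alpha> * payoff \<xi> + w * (1 - \<alpha>) * payoff \<eta>"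
      by (simp add: algebra_simps)
    also have "\<dots> = (t - cost \<eta>) * payoff \<xi> + (cost \<xi> - t) * payoff \<eta>"
      by (simp only: wa wb)
    finally have "(t - cost \<eta>) * (payoff \<xi> - V) \<le> (cost \<xi> - t) * (V - payoff \<eta>)"
      by (simp add: w_def algebra_simps)
    then show ?thesis
      unfolding \<xi>(2) using \<xi>(1) less by (simp add: pos_divide_le_eq pos_le_divide_eq mult.commute)
  qed
  have bdd: "bdd_above S"
    using bound[of _ x] t by (auto simp: cost_center intro!: bdd_aboveI)
  define lam where "lam = Sup S"
  have lam0: "0 \<le> lam" unfolding lam_def by (rule cSup_upper[OF _ bdd]) (simp add: S_def)
  have "payoff \<xi> - lam * cost \<xi> \<le> V - lam * t" for \<xi>
  proof -
    consider "cost \<xi> < t" | "cost \<xi> = t" | "t < cost \<xi>" by linarith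
    then show ?thesis
    proof cases
      case 1
      have "lam \<le> (V - payoff \<xi>) / (t - cost \<xi>)"
        unfolding lam_def by (rule cSup_least) (auto simp: S_def bound[OF _ 1, unfolded S_def])
      then show ?thesis using 1 by (simp add: field_simps)
    next
      case 2
      then show ?thesis using single[of \<xi>] by simp
    next
      case 3
      have "(payoff \<xi> - V) / (cost \<xi> - t) \<le> lam"
        unfolding lam_def by (rule cSup_upper[OF _ bdd]) (use 3 in \<open>auto simp: S_def\<close>)
      then show ?thesis using 3 by (simp add: field_simps)
    qed
  qed
  then show ?thesis using that lam0 by (simp add: t_def)
qed

text \<open>
  The supporting line bounds the sum of \<open>\<lambda> d(\<xi> i, x i)^p - \<Psi> (\<xi> i)\<close> from below over all configurations.
  Varying one coordinate alone shows that each infimum \<open>\<Phi>(\<lambda>, x i)\<close> is finite; varying all of them gives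
  \<open>h \<lambda> \<le> V\<close>.
\<close>
lemma dual_attained:
  assumes "mixture_value < \<infinity>"
  obtains lam where "0 \<le> lam" "dual_objective p \<theta> \<nu> \<Psi> lam \<le> mixture_value"
proof -
  have "ereal (payoff x) \<le> mixture_value"
    by (rule payoff_le_mixture_value) (simp add: cost_center)
  with assms obtain V where V: "mixture_value = ereal V"
    by (cases mixture_value) auto
  obtain lam where lam: "0 \<le> lam" "\<And>\<xi>. payoff \<xi> - lam * cost \<xi> \<le> V - lam * \<theta> powr p"
    by (rule supporting_slope[OF V]) blast
  let ?s = "\<lambda>y i. lam * dist y (x i) powr p - \<Psi> y"
  have fin: "Phi_finite lam"
    unfolding Phi_finite_def
  proof
    fix i assume i: "i \<in> {1..N}"
    define R where "R = (\<Sum>k\<in>{1..N} - {i}. ?s (x k) k)"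
    have "real N * (lam * \<theta> powr p - V) - R \<le> ?s y i" for y
    proof -
      have "lam * \<theta> powr p - V \<le> avg (\<lambda>k. ?s ((x(i := y)) k) k)"
        unfolding avg_slack using lam(2)[of "x(i := y)"] by linarith
      also have "(\<Sum>k=1..N. ?s ((x(i := y)) k) k) = ?s y i + R"
        using i by (subst sum.remove[of _ i]) (auto simp: R_def intro!: sum.cong)
      then have "avg (\<lambda>k. ?s ((x(i := y)) k) k) = (?s y i + R) / real N"
        by (simp add: avg_def)
      finally show ?thesis using N by (simp add: field_simps)
    qed
    then have "ereal (real N * (lam * \<theta> powr p - V) - R) \<le> Phi p \<Psi> lam (x i)"
      unfolding Phi_def by (intro INF_greatest) simp
    then show "- \<infinity> < Phi p \<Psi> lam (x i)"
      by (rule less_le_trans[rotated]) simp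
  qed
  have "lam * \<theta> powr p - avg (\<lambda>i. phi lam (x i)) \<le> V"
  proof (rule field_le_epsilon)
    fix e :: real assume "0 < e"
    obtain \<xi> where "\<And>i. i \<in> {1..N} \<Longrightarrow> ?s (\<xi> i) i \<le> phi lam (x i) + e"
      by (rule near_minimizers[OF fin \<open>0 < e\<close>]) blast
    then have "avg (\<lambda>i. ?s (\<xi> i) i) \<le> avg (\<lambda>i. phi lam (x i) + e)"
      by (rule avg_mono)
    then show "lam * \<theta> powr p - avg (\<lambda>i. phi lam (x i)) \<le> V + e"
      using lam(2)[of \<xi>] by (simp add: avg_slack avg_add avg_const)
  qed
  then show ?thesis using that[OF lam(1)] fin V by (simp add: dual_objective_eq)
qed

theorem strong_duality:
  "primal_value p \<theta> \<nu> \<Psi> = dual_value p \<theta> \<nu> \<Psi>" "mixture_value = dual_value p \<theta> \<nu> \<Psi>"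
proof -
  have "dual_value p \<theta> \<nu> \<Psi> \<le> mixture_value"
  proof (cases "mixture_value < \<infinity>")
    case True
    then obtain lam where "0 \<le> lam" "dual_objective p \<theta> \<nu> \<Psi> lam \<le> mixture_value"
      by (rule dual_attained)
    then show ?thesis unfolding dual_value_def by (intro INF_lower2[of lam]) auto
  qed (simp add: not_less top.extremum_unique)
  with mixture_value_le_primal primal_le_dual
  show "primal_value p \<theta> \<nu> \<Psi> = dual_value p \<theta> \<nu> \<Psi>" "mixture_value = dual_value p \<theta> \<nu> \<Psi>"
    by (auto intro: antisym order_trans)
qed

section \<open>Dual minimizers\<close>

lemma dual_minimizer_iff:
  "dual_minimizer p \<theta> \<nu> \<Psi> lam \<longleftrightarrow> 0 \<le> lam \<and> dual_objective p \<theta> \<nu> \<Psi> lam = dual_value p \<theta> \<nu> \<Psi>"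
proof
  assume "dual_minimizer p \<theta> \<nu> \<Psi> lam"
  then have lam: "0 \<le> lam" "\<And>l. 0 \<le> l \<Longrightarrow> dual_objective p \<theta> \<nu> \<Psi> lam \<le> dual_objective p \<theta> \<nu> \<Psi> l"
    by (auto simp: dual_minimizer_def is_arg_min_def not_less)
  moreover have "dual_objective p \<theta> \<nu> \<Psi> lam = dual_value p \<theta> \<nu> \<Psi>"
    unfolding dual_value_def using lam by (intro antisym INF_greatest INF_lower2[of lam]) auto
  ultimately show "0 \<le> lam \<and> dual_objective p \<theta> \<nu> \<Psi> lam = dual_value p \<theta> \<nu> \<Psi>" by blast
next
  assume lam: "0 \<le> lam \<and> dual_objective p \<theta> \<nu> \<Psi> lam = dual_value p \<theta> \<nu> \<Psi>"
  have "dual_value p \<theta> \<nu> \<Psi> \<le> dual_objective p \<theta> \<nu> \<Psi> l" if "0 \<le> l" for l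
    unfolding dual_value_def using that by (intro INF_lower) simp
  then show "dual_minimizer p \<theta> \<nu> \<Psi> lam"
    using lam by (auto simp: dual_minimizer_def is_arg_min_def not_less)
qed

lemma dual_minimizer_exists:
  assumes "primal_value p \<theta> \<nu> \<Psi> < \<infinity>"
  shows "\<exists>lam. dual_minimizer p \<theta> \<nu> \<Psi> lam"
proof -
  have "mixture_value < \<infinity>" using assms strong_duality by simp
  then obtain lam where lam: "0 \<le> lam" "dual_objective p \<theta> \<nu> \<Psi> lam \<le> mixture_value"
    by (rule dual_attained)
  moreover have "dual_value p \<theta> \<nu> \<Psi> \<le> dual_objective p \<theta> \<nu> \<Psi> lam"
    unfolding dual_value_def using lam(1) by (intro INF_lower) simp
  ultimately show ?thesis
    unfolding dual_minimizer_iff using strong_duality(2) by (auto intro!: exI[of _ lam] antisym)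
qed

lemma dual_minimizer_value:
  assumes "dual_minimizer p \<theta> \<nu> \<Psi> lam" and "dual_value p \<theta> \<nu> \<Psi> < \<infinity>"
  shows "Phi_finite lam"
    and "dual_value p \<theta> \<nu> \<Psi> = ereal (lam * \<theta> powr p - avg (\<lambda>i. phi lam (x i)))"
proof -
  have eq: "dual_objective p \<theta> \<nu> \<Psi> lam = dual_value p \<theta> \<nu> \<Psi>"
    using assms(1) by (simp add: dual_minimizer_iff)
  show "Phi_finite lam"
    using assms(2) unfolding eq[symmetric] dual_objective_eq by (auto split: if_splits)
  then show "dual_value p \<theta> \<nu> \<Psi> = ereal (lam * \<theta> powr p - avg (\<lambda>i. phi lam (x i)))"
    unfolding eq[symmetric] dual_objective_eq by simp
qed

section \<open>Zeros of the slack along approximately optimal couplings\<close>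

text \<open>
  With \<open>F = h\<close> on \<open>{s > 0}\<close> and \<open>0\<close> elsewhere, \<open>F \<le> k s + max 0 (F - k s)\<close>. For \<open>k \<rightarrow> \<infinity>\<close> the last term tends to \<open>0\<close>
  pointwise and is dominated by \<open>h\<close>, and summed over the samples it depends only on \<open>\<xi>\<close>; so its integral is small
  under \<open>\<mu>\<close>, hence under all couplings simultaneously.
\<close>
lemma absorb_on_positive:
  assumes s: "section_integrable \<mu> s" and h: "section_integrable \<mu> h"
    and s0: "\<And>\<xi> \<zeta>. \<zeta> \<in> centers \<Longrightarrow> 0 \<le> s \<xi> \<zeta>" and h0: "\<And>\<xi> \<zeta>. \<zeta> \<in> centers \<Longrightarrow> 0 \<le> h \<xi> \<zeta>"
    and \<epsilon>: "0 < \<epsilon>"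
  obtains k :: real where "0 \<le> k"
    and "\<And>\<gamma>. \<gamma> \<in> couplings \<mu> \<nu> \<Longrightarrow>
      coupling_mean \<gamma> (\<lambda>\<xi> \<zeta>. if 0 < s \<xi> \<zeta> then h \<xi> \<zeta> else 0) \<le> k * coupling_mean \<gamma> s + \<epsilon>"
proof -
  define F where "F \<xi> \<zeta> = (if 0 < s \<xi> \<zeta> then h \<xi> \<zeta> else 0)" for \<xi> \<zeta>
  define R where "R k \<xi> = (\<Sum>\<zeta>\<in>centers. max 0 (F \<xi> \<zeta> - real k * s \<xi> \<zeta>))" for k :: nat and \<xi>
  have meas: "(\<lambda>\<xi>. s \<xi> \<zeta>) \<in> borel_measurable \<mu>" "(\<lambda>\<xi>. h \<xi> \<zeta>) \<in> borel_measurable \<mu>"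
    if "\<zeta> \<in> centers" for \<zeta>
    using s h that by (auto simp: section_integrable_def)
  have Fmeas: "(\<lambda>\<xi>. F \<xi> \<zeta>) \<in> borel_measurable \<mu>" if "\<zeta> \<in> centers" for \<zeta>
    unfolding F_def using meas[OF that] by measurable
  have Rmeas: "R k \<in> borel_measurable \<mu>" for k
    unfolding R_def using Fmeas meas by (intro borel_measurable_sum) simp
  have F: "section_integrable \<mu> F"
    unfolding section_integrable_def
  proof
    fix \<zeta> assume \<zeta>: "\<zeta> \<in> centers"
    show "integrable \<mu> (\<lambda>\<xi>. F \<xi> \<zeta>)"
      by (rule Bochner_Integration.integrable_bound[of _ "\<lambda>\<xi>. h \<xi> \<zeta>"])
        (use \<zeta> h Fmeas in \<open>auto simp: section_integrable_def F_def\<close>)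
  qed
  have hint: "integrable \<mu> (\<lambda>\<xi>. \<Sum>\<zeta>\<in>centers. h \<xi> \<zeta>)"
    using h by (auto simp: section_integrable_def)
  have Rbound: "norm (R k \<xi>) \<le> (\<Sum>\<zeta>\<in>centers. h \<xi> \<zeta>)" for k \<xi>
  proof -
    have "max 0 (F \<xi> \<zeta> - real k * s \<xi> \<zeta>) \<le> h \<xi> \<zeta>" if "\<zeta> \<in> centers" for \<zeta>
      using s0[OF that, of \<xi>] h0[OF that, of \<xi>] by (simp add: F_def add_increasing2)
    then show ?thesis unfolding R_def
      by (subst real_norm_def, subst abs_of_nonneg) (auto intro!: sum_mono sum_nonneg)
  qed
  have "(\<lambda>k. R k \<xi>) \<longlonglongrightarrow> 0" for \<xi>
  proof -
    have "(\<lambda>k. max 0 (F \<xi> \<zeta> - real k * s \<xi> \<zeta>)) \<longlonglongrightarrow> 0" if "\<zeta> \<in> centers" for \<zeta>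
    proof (rule tendsto_eventually)
      show "\<forall>\<^sub>F k in sequentially. max 0 (F \<xi> \<zeta> - real k * s \<xi> \<zeta>) = 0"
      proof (cases "0 < s \<xi> \<zeta>")
        case True
        obtain n :: nat where n: "F \<xi> \<zeta> / s \<xi> \<zeta> \<le> real n"
          using real_arch_simple by blast
        have "F \<xi> \<zeta> \<le> real k * s \<xi> \<zeta>" if "n \<le> k" for k
        proof -
          have "F \<xi> \<zeta> / s \<xi> \<zeta> \<le> real k" using n that by linarith
          then show ?thesis using True by (simp add: pos_divide_le_eq)
        qed
        then show ?thesis by (intro eventually_sequentiallyI[of n]) (simp add: max_absorb1)
      next
        case False
        then show ?thesis using s0[OF that, of \<xi>] by (simp add: F_def)
      qed
    qed
    then have "(\<lambda>k. R k \<xi>) \<longlonglongrightarrow> (\<Sum>\<zeta>\<in>centers. 0)"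
      unfolding R_def by (rule tendsto_sum)
    then show ?thesis by simp
  qed
  then have "(\<lambda>k. \<integral>\<xi>. R k \<xi> \<partial>\<mu>) \<longlonglongrightarrow> (\<integral>\<xi>. 0 \<partial>\<mu>)"
    by (intro integral_dominated_convergence[where w="\<lambda>\<xi>. \<Sum>\<zeta>\<in>centers. h \<xi> \<zeta>"])
      (auto simp: Rmeas hint Rbound simp del: real_norm_def)
  then have "\<forall>\<^sub>F k in sequentially. (\<integral>\<xi>. R k \<xi> \<partial>\<mu>) < \<epsilon>"
    using \<epsilon> by (intro order_tendstoD) simp_all
  then obtain k where k: "(\<integral>\<xi>. R k \<xi> \<partial>\<mu>) < \<epsilon>"
    by (auto simp: eventually_sequentially)
  have Rint: "integrable \<mu> (R k)"
    by (rule Bochner_Integration.integrable_bound[OF hint Rmeas])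
      (use Rbound in \<open>auto intro: order_trans[OF _ abs_ge_self]\<close>)
  have "coupling_mean \<gamma> F \<le> real k * coupling_mean \<gamma> s + \<epsilon>" if g: "\<gamma> \<in> couplings \<mu> \<nu>" for \<gamma>
  proof -
    have "coupling_mean \<gamma> F \<le> coupling_mean \<gamma> (\<lambda>\<xi> \<zeta>. real k * s \<xi> \<zeta> + R k \<xi>)"
    proof (rule coupling_mean_mono[OF g F])
      fix \<zeta> assume \<zeta>: "\<zeta> \<in> centers"
      have "F \<xi> \<zeta> \<le> real k * s \<xi> \<zeta> + R k \<xi>" for \<xi>
      proof -
        have "max 0 (F \<xi> \<zeta> - real k * s \<xi> \<zeta>) \<le> R k \<xi>"
          unfolding R_def using \<zeta> by (intro member_le_sum) auto
        then show ?thesis by linarith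
      qed
      then show "AE \<xi> in \<mu>. F \<xi> \<zeta> \<le> real k * s \<xi> \<zeta> + R k \<xi>" by simp
    qed (intro section_integrable_add section_integrable_cmult s section_integrable_fst Rint)
    also have "\<dots> = real k * coupling_mean \<gamma> s + (\<integral>\<xi>. R k \<xi> \<partial>\<mu>)"
      by (simp add: coupling_mean_add[OF g section_integrable_cmult[OF s] section_integrable_fst[OF Rint]]
          coupling_mean_cmult[OF g] coupling_mean_fst[OF g Rint])
    finally show ?thesis using k by linarith
  qed
  then show ?thesis using that[of "real k"] unfolding F_def by auto
qed

lemma avg_indicator_pos:
  assumes "\<zeta> \<in> centers"
  shows "0 < avg (\<lambda>i. if x i = \<zeta> then 1 else 0)"
proof -
  obtain i where i: "i \<in> {1..N}" "x i = \<zeta>" using assms by (auto simp: centers_def)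
  have "(\<lambda>i. if x i = \<zeta> then 1 else 0) i \<le> real N * avg (\<lambda>i. if x i = \<zeta> then 1 else 0)"
    using i(1) by (rule avg_ge_point) auto
  then have "0 < real N * avg (\<lambda>i. if x i = \<zeta> then 1 else 0)" using i(2) by simp
  then show ?thesis by (simp add: zero_less_mult_iff)
qed

text \<open>
  The function \<open>g\<close> equal to \<open>s\<close> where \<open>s > 0\<close> and to \<open>f\<close> where \<open>s = 0\<close> is nonnegative and is positive in
  the section of \<open>z\<close>, which carries positive mass. By \<open>absorb_on_positive\<close>, applied to the indicator of that
  section, the mean of \<open>g\<close> is bounded below uniformly in the coupling. If the mean of \<open>s\<close> is small, then by the
  same lemma \<open>f\<close> contributes little on \<open>{s > 0}\<close>, so that the means of \<open>f\<close> and \<open>g\<close> nearly agree.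
\<close>
lemma no_small_coupling:
  assumes pr: "prob_space \<mu>"
    and s: "section_integrable \<mu> s" and f: "section_integrable \<mu> f"
    and s0: "\<And>\<xi> \<zeta>. \<zeta> \<in> centers \<Longrightarrow> 0 \<le> s \<xi> \<zeta>"
    and f0: "\<And>\<xi> \<zeta>. \<zeta> \<in> centers \<Longrightarrow> s \<xi> \<zeta> = 0 \<Longrightarrow> 0 \<le> f \<xi> \<zeta>"
    and z: "z \<in> centers" and fz: "\<And>\<xi>. s \<xi> z = 0 \<Longrightarrow> 0 < f \<xi> z"
  obtains \<delta> where "0 < \<delta>"
    and "\<And>\<gamma>. \<gamma> \<in> couplings \<mu> \<nu> \<Longrightarrow> coupling_mean \<gamma> s \<le> \<delta> \<Longrightarrow> \<delta> < coupling_mean \<gamma> f"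
proof -
  define fp where "fp \<xi> \<zeta> = (if 0 < s \<xi> \<zeta> then f \<xi> \<zeta> else 0)" for \<xi> \<zeta>
  define fa where "fa \<xi> \<zeta> = (if 0 < s \<xi> \<zeta> then \<bar>f \<xi> \<zeta>\<bar> else 0)" for \<xi> \<zeta>
  define g where "g \<xi> \<zeta> = s \<xi> \<zeta> + f \<xi> \<zeta> - fp \<xi> \<zeta>" for \<xi> \<zeta>
  have abs: "section_integrable \<mu> (\<lambda>\<xi> \<zeta>. \<bar>f \<xi> \<zeta>\<bar>)"
    using f by (simp add: section_integrable_def)
  have fpa: "section_integrable \<mu> fp" "section_integrable \<mu> fa"
    unfolding section_integrable_def
  proof (safe)
    fix \<zeta> assume \<zeta>: "\<zeta> \<in> centers"
    have i: "integrable \<mu> (\<lambda>\<xi>. f \<xi> \<zeta>)" and "(\<lambda>\<xi>. s \<xi> \<zeta>) \<in> borel_measurable \<mu>"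
      using s f \<zeta> by (auto simp: section_integrable_def)
    then have m: "(\<lambda>\<xi>. fp \<xi> \<zeta>) \<in> borel_measurable \<mu>" "(\<lambda>\<xi>. fa \<xi> \<zeta>) \<in> borel_measurable \<mu>"
      unfolding fp_def fa_def by measurable
    show "integrable \<mu> (\<lambda>\<xi>. fp \<xi> \<zeta>)" "integrable \<mu> (\<lambda>\<xi>. fa \<xi> \<zeta>)"
      by (rule Bochner_Integration.integrable_bound[OF i m(1)], simp add: fp_def,
          rule Bochner_Integration.integrable_bound[OF i m(2)], simp add: fa_def)
  qed
  have gint: "section_integrable \<mu> g"
    unfolding g_def by (intro section_integrable_diff section_integrable_add s f fpa)
  have g_alt: "g \<xi> \<zeta> = (if 0 < s \<xi> \<zeta> then s \<xi> \<zeta> else f \<xi> \<zeta>)" if "\<zeta> \<in> centers" for \<xi> \<zeta>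
    using s0[OF that, of \<xi>] by (auto simp: g_def fp_def)
  have g0: "0 \<le> g \<xi> \<zeta>" if "\<zeta> \<in> centers" for \<xi> \<zeta>
    using g_alt[OF that, of \<xi>] s0[OF that, of \<xi>] f0[OF that, of \<xi>] by auto
  have gz: "0 < g \<xi> z" for \<xi>
    using g_alt[OF z, of \<xi>] s0[OF z, of \<xi>] fz[of \<xi>] by auto
  define w where "w = avg (\<lambda>i. if x i = z then 1 else 0)"
  have w: "0 < w" unfolding w_def by (rule avg_indicator_pos[OF z])
  let ?h = "\<lambda>\<xi> \<zeta>. if \<zeta> = z then 1 else 0 :: real"
  have hint: "section_integrable \<mu> ?h" by (rule section_integrable_center[OF pr])
  obtain k1 where k1: "0 \<le> k1" "\<And>\<gamma>. \<gamma> \<in> couplings \<mu> \<nu> \<Longrightarrow>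
      coupling_mean \<gamma> (\<lambda>\<xi> \<zeta>. if 0 < g \<xi> \<zeta> then ?h \<xi> \<zeta> else 0) \<le> k1 * coupling_mean \<gamma> g + w / 2"
    by (rule absorb_on_positive[OF gint hint g0, of "w/2"]) (use w in auto)
  define \<beta> where "\<beta> = w / (2 * (k1 + 1))"
  have \<beta>: "0 < \<beta>" using w k1(1) by (simp add: \<beta>_def)
  have lower: "\<beta> \<le> coupling_mean \<gamma> g" if \<gamma>: "\<gamma> \<in> couplings \<mu> \<nu>" for \<gamma>
  proof -
    have "(\<lambda>\<xi> \<zeta>. if 0 < g \<xi> \<zeta> then ?h \<xi> \<zeta> else 0) = ?h"
      using gz by (auto simp: fun_eq_iff)
    then have "w \<le> k1 * coupling_mean \<gamma> g + w / 2"
      using k1(2)[OF \<gamma>] coupling_mean_center[OF \<gamma>, of "\<lambda>\<zeta>. if \<zeta> = z then 1 else 0"]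
      by (simp add: w_def)
    moreover have "0 \<le> coupling_mean \<gamma> g"
      using coupling_mean_mono[OF \<gamma> section_integrable_center[OF pr, of "\<lambda>_. 0"] gint] g0
        coupling_mean_center[OF \<gamma>, of "\<lambda>_. 0"] by (simp add: avg_const)
    ultimately have "w \<le> coupling_mean \<gamma> g * (2 * (k1 + 1))" by (simp add: algebra_simps)
    then show ?thesis using k1(1) unfolding \<beta>_def by (subst pos_divide_le_eq) auto
  qed
  obtain k2 where k2: "0 \<le> k2" "\<And>\<gamma>. \<gamma> \<in> couplings \<mu> \<nu> \<Longrightarrow>
      coupling_mean \<gamma> fa \<le> k2 * coupling_mean \<gamma> s + \<beta> / 4"
    unfolding fa_def
    by (rule absorb_on_positive[OF s abs s0, of "\<beta> / 4"]) (use \<beta> in auto)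
  define \<delta> where "\<delta> = \<beta> / (4 * (k2 + 2))"
  have \<delta>: "0 < \<delta>" using \<beta> k2(1) by (simp add: \<delta>_def)
  have "(k2 + 2) * \<delta> = \<beta> / 4" using k2(1) by (simp add: \<delta>_def field_simps)
  then have \<delta>sum: "k2 * \<delta> + 2 * \<delta> = \<beta> / 4" by (simp add: algebra_simps)
  have "\<delta> < coupling_mean \<gamma> f" if \<gamma>: "\<gamma> \<in> couplings \<mu> \<nu>" and small: "coupling_mean \<gamma> s \<le> \<delta>" for \<gamma>
  proof (rule ccontr)
    assume "\<not> \<delta> < coupling_mean \<gamma> f"
    then have "coupling_mean \<gamma> f \<le> \<delta>" by simp
    have "coupling_mean \<gamma> g = coupling_mean \<gamma> s + coupling_mean \<gamma> f - coupling_mean \<gamma> fp"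
      unfolding g_def
      by (simp add: coupling_mean_diff[OF \<gamma> section_integrable_add[OF s f] fpa(1)] coupling_mean_add[OF \<gamma> s f])
    moreover have "coupling_mean \<gamma> (\<lambda>\<xi> \<zeta>. (-1) * fp \<xi> \<zeta>) \<le> coupling_mean \<gamma> fa"
      by (rule coupling_mean_mono[OF \<gamma> section_integrable_cmult[OF fpa(1)] fpa(2)]) (auto simp: fp_def fa_def)
    then have "- coupling_mean \<gamma> fp \<le> coupling_mean \<gamma> fa"
      unfolding coupling_mean_cmult[OF \<gamma>] by simp
    moreover have "k2 * coupling_mean \<gamma> s \<le> k2 * \<delta>" using small k2(1) by (rule mult_left_mono)
    ultimately show False
      using lower[OF \<gamma>] k2(2)[OF \<gamma>] small \<open>coupling_mean \<gamma> f \<le> \<delta>\<close> \<delta>sum \<beta> by linarith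
  qed
  then show ?thesis using that \<delta> by blast
qed

text \<open>
  Suppose that every choice of zeros of \<open>s\<close> has \<open>f\<close>-mean above \<open>t\<close>. Then \<open>f\<close> is bounded below on the zeros in each
  section, and the infima \<open>lo\<close> have mean at least \<open>t\<close>. Either all infima are attained, their mean exceeds \<open>t\<close> and
  they can be lowered a little, or some infimum is not attained. In both cases there is a function \<open>l\<close> with mean at
  least \<open>t\<close> and \<open>l \<le> f\<close> on the zeros, strictly in some section, and \<open>no_small_coupling\<close> for \<open>f - l\<close> contradicts the
  assumed couplings. That zeros exist in each section follows from \<open>no_small_coupling\<close> for the zero function.
\<close>
lemma select_configuration:
  assumes pr: "prob_space \<mu>"
    and s: "section_integrable \<mu> s" and f: "section_integrable \<mu> f"
    and s0: "\<And>\<xi> \<zeta>. \<zeta> \<in> centers \<Longrightarrow> 0 \<le> s \<xi> \<zeta>"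
    and approx: "\<And>\<delta>. 0 < \<delta> \<Longrightarrow> \<exists>\<gamma>\<in>couplings \<mu> \<nu>. coupling_mean \<gamma> s \<le> \<delta> \<and> coupling_mean \<gamma> f \<le> t + \<delta>"
  shows "\<exists>\<xi>. (\<forall>i\<in>{1..N}. s (\<xi> i) (x i) = 0) \<and> avg (\<lambda>i. f (\<xi> i) (x i)) \<le> t"
proof (rule ccontr)
  assume none: "\<not> ?thesis"
  have big: "t < avg (\<lambda>i. f (\<xi> i) (x i))" if "\<And>i. i \<in> {1..N} \<Longrightarrow> s (\<xi> i) (x i) = 0" for \<xi>
    using none that by (meson not_less)
  have "\<exists>y. s y z = 0" if z: "z \<in> centers" for z
  proof (rule ccontr)
    assume none: "\<not> (\<exists>y. s y z = 0)"
    obtain \<delta> where \<delta>: "0 < \<delta>" "\<And>\<gamma>. \<gamma> \<in> couplings \<mu> \<nu> \<Longrightarrow> coupling_mean \<gamma> s \<le> \<delta> \<Longrightarrow> \<delta> < coupling_mean \<gamma> (\<lambda>\<xi> \<zeta>. 0)"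
      by (rule no_small_coupling[OF pr s section_integrable_center[OF pr, of "\<lambda>_. 0"] s0 _ z])
        (use none in auto)
    obtain \<gamma> where \<gamma>: "\<gamma> \<in> couplings \<mu> \<nu>" "coupling_mean \<gamma> s \<le> \<delta>" using approx[OF \<delta>(1)] by blast
    then show False using \<delta>(1) \<delta>(2)[OF \<gamma>] coupling_mean_center[OF \<gamma>(1), of "\<lambda>_. 0"] by (simp add: avg_const)
  qed
  then obtain c where c: "\<And>z. z \<in> centers \<Longrightarrow> s (c z) z = 0" by metis
  define lo where "lo z = Inf ((\<lambda>y. f y z) ` {y. s y z = 0})" for z
  have bdd: "bdd_below ((\<lambda>y. f y (x i)) ` {y. s y (x i) = 0})" if i: "i \<in> {1..N}" for i
  proof -
    define R where "R = (\<Sum>k\<in>{1..N} - {i}. f (c (x k)) (x k))"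
    have "real N * t - R \<le> f y (x i)" if y: "s y (x i) = 0" for y
    proof -
      define \<xi> where "\<xi> k = (if k = i then y else c (x k))" for k
      have "t < avg (\<lambda>k. f (\<xi> k) (x k))"
        by (rule big) (use y c in \<open>auto simp: \<xi>_def\<close>)
      moreover have "(\<Sum>k=1..N. f (\<xi> k) (x k)) = f y (x i) + R"
        using i by (subst sum.remove[of _ i]) (auto simp: R_def \<xi>_def intro!: sum.cong)
      ultimately have "t < (f y (x i) + R) / real N" by (simp add: avg_def)
      then show ?thesis using N by (simp add: field_simps)
    qed
    then show ?thesis by (auto intro!: bdd_belowI2)
  qed
  have lo_le: "lo (x i) \<le> f y (x i)" if "i \<in> {1..N}" "s y (x i) = 0" for i y
    unfolding lo_def using that by (intro cInf_lower bdd) auto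
  have "t \<le> avg (\<lambda>i. lo (x i))"
  proof (rule field_le_epsilon)
    fix e :: real assume e: "0 < e"
    have "\<exists>y. s y (x i) = 0 \<and> f y (x i) < lo (x i) + e" if i: "i \<in> {1..N}" for i
    proof -
      have "(\<lambda>y. f y (x i)) ` {y. s y (x i) = 0} \<noteq> {}" using c[OF center_in[OF i]] by auto
      then show ?thesis
        using cInf_lessD[of "(\<lambda>y. f y (x i)) ` {y. s y (x i) = 0}" "lo (x i) + e"] e
        by (auto simp: lo_def)
    qed
    then obtain \<xi> where \<xi>: "\<And>i. i \<in> {1..N} \<Longrightarrow> s (\<xi> i) (x i) = 0 \<and> f (\<xi> i) (x i) < lo (x i) + e"
      by metis
    have "t < avg (\<lambda>i. f (\<xi> i) (x i))" by (rule big) (use \<xi> in auto)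
    also have "\<dots> \<le> avg (\<lambda>i. lo (x i) + e)" by (rule avg_mono) (use \<xi> in \<open>auto intro: less_imp_le\<close>)
    finally show "t \<le> avg (\<lambda>i. lo (x i)) + e" by (simp add: avg_add avg_const)
  qed
  have "\<exists>l z. z \<in> centers \<and> t \<le> avg (\<lambda>i. l (x i)) \<and>
    (\<forall>\<zeta>\<in>centers. \<forall>y. s y \<zeta> = 0 \<longrightarrow> l \<zeta> \<le> f y \<zeta>) \<and> (\<forall>y. s y z = 0 \<longrightarrow> l z < f y z)"
  proof (cases "\<forall>i\<in>{1..N}. \<exists>y. s y (x i) = 0 \<and> f y (x i) = lo (x i)")
    case True
    then obtain \<xi> where \<xi>: "\<And>i. i \<in> {1..N} \<Longrightarrow> s (\<xi> i) (x i) = 0 \<and> f (\<xi> i) (x i) = lo (x i)"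
      by metis
    have "t < avg (\<lambda>i. f (\<xi> i) (x i))" by (rule big) (use \<xi> in auto)
    also have "\<dots> = avg (\<lambda>i. lo (x i))" by (rule avg_cong) (use \<xi> in auto)
    finally have gap: "t < avg (\<lambda>i. lo (x i))" .
    define l where "l z = lo z - (avg (\<lambda>i. lo (x i)) - t)" for z
    have less: "l \<zeta> < f y \<zeta>" if "\<zeta> \<in> centers" "s y \<zeta> = 0" for \<zeta> y
      using that lo_le[of _ y] gap by (fastforce simp: centers_def l_def)
    have "avg (\<lambda>i. l (x i)) = t"
      by (simp add: l_def avg_diff avg_const)
    moreover have "x 1 \<in> centers" using N by simp
    ultimately show ?thesis using less by (intro exI[of _ l] exI[of _ "x 1"]) (auto intro: less_imp_le)
  next
    case False
    then obtain j where j: "j \<in> {1..N}" "\<And>y. s y (x j) = 0 \<Longrightarrow> f y (x j) \<noteq> lo (x j)" by blast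
    have "lo (x j) < f y (x j)" if "s y (x j) = 0" for y
      using lo_le[OF j(1) that] j(2)[OF that] by simp
    moreover have "lo \<zeta> \<le> f y \<zeta>" if "\<zeta> \<in> centers" "s y \<zeta> = 0" for \<zeta> y
      using that lo_le[of _ y] by (auto simp: centers_def)
    ultimately show ?thesis
      using j(1) \<open>t \<le> avg (\<lambda>i. lo (x i))\<close> by (intro exI[of _ lo] exI[of _ "x j"]) auto
  qed
  then obtain l z where z: "z \<in> centers" and l: "t \<le> avg (\<lambda>i. l (x i))"
    "\<And>\<zeta> y. \<zeta> \<in> centers \<Longrightarrow> s y \<zeta> = 0 \<Longrightarrow> l \<zeta> \<le> f y \<zeta>" "\<And>y. s y z = 0 \<Longrightarrow> l z < f y z"
    by blast
  have lint: "section_integrable \<mu> (\<lambda>\<xi> \<zeta>. l \<zeta>)" by (rule section_integrable_center[OF pr])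
  obtain \<delta> where \<delta>: "0 < \<delta>"
    "\<And>\<gamma>. \<gamma> \<in> couplings \<mu> \<nu> \<Longrightarrow> coupling_mean \<gamma> s \<le> \<delta> \<Longrightarrow> \<delta> < coupling_mean \<gamma> (\<lambda>\<xi> \<zeta>. f \<xi> \<zeta> - l \<zeta>)"
    by (rule no_small_coupling[OF pr s section_integrable_diff[OF f lint] s0 _ z]) (use l in auto)
  obtain \<gamma> where \<gamma>: "\<gamma> \<in> couplings \<mu> \<nu>" "coupling_mean \<gamma> s \<le> \<delta>" "coupling_mean \<gamma> f \<le> t + \<delta>"
    using approx[OF \<delta>(1)] by blast
  have "coupling_mean \<gamma> (\<lambda>\<xi> \<zeta>. f \<xi> \<zeta> - l \<zeta>) = coupling_mean \<gamma> f - avg (\<lambda>i. l (x i))"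
    by (simp add: coupling_mean_diff[OF \<gamma>(1) f lint] coupling_mean_center[OF \<gamma>(1)])
  then show False using \<delta>(2)[OF \<gamma>(1,2)] \<gamma>(3) l(1) by linarith
qed

section \<open>Structure of worst-case distributions\<close>

text \<open>
  A discrete intermediate value argument along \<open>h m\<close>, which agrees with \<open>hi\<close> up to index \<open>m\<close> and with \<open>lo\<close> beyond it.
  For \<open>\<lambda> = 0\<close> the budget does not have to be exhausted, and \<open>lo\<close> is used unsplit.
\<close>
lemma split_one_sample:
  assumes lo: "cost lo \<le> t" and hi: "lam \<noteq> 0 \<Longrightarrow> t \<le> cost hi"
    and P: "\<And>i. i \<in> {1..N} \<Longrightarrow> P i (lo i)" "\<And>i. i \<in> {1..N} \<Longrightarrow> lam \<noteq> 0 \<Longrightarrow> P i (hi i)"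
  obtains i0 q a b where "i0 \<in> {1..N}" "0 \<le> q" "q \<le> 1" "\<And>i. i \<noteq> i0 \<Longrightarrow> a i = b i"
    and "\<And>i. i \<in> {1..N} \<Longrightarrow> P i (a i)" "\<And>i. i \<in> {1..N} \<Longrightarrow> P i (b i)"
    and "q * cost a + (1 - q) * cost b \<le> t"
    and "lam * (q * cost a + (1 - q) * cost b) = lam * t"
proof (cases "lam = 0 \<or> cost lo = t")
  case True
  then show ?thesis using that[of 1 1 lo lo] N lo P(1) by auto
next
  case False
  then have lam: "lam \<noteq> 0" and less: "cost lo < t" using lo by auto
  define h where "h m i = (if i \<le> m then hi i else lo i)" for m i :: nat
  have "cost (h 0) = cost lo" "cost (h N) = cost hi"
    unfolding cost_def by (auto intro!: avg_cong simp: h_def)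
  define m where "m = (LEAST m. t \<le> cost (h m))"
  have "t \<le> cost (h N)" using hi[OF lam] \<open>cost (h N) = cost hi\<close> by simp
  then have m: "t \<le> cost (h m)" "m \<le> N"
    unfolding m_def by (rule LeastI[where P="\<lambda>m. t \<le> cost (h m)"], rule Least_le)
  have "m \<noteq> 0" using m(1) \<open>cost (h 0) = cost lo\<close> less by (metis not_less)
  then have pred: "cost (h (m - 1)) < t"
    using not_less_Least[of "m - 1" "\<lambda>m. t \<le> cost (h m)"] unfolding m_def[symmetric] by auto
  define w where "w = cost (h m) - cost (h (m - 1))"
  define q where "q = (cost (h m) - t) / w"
  have w: "0 < w" using m(1) pred by (simp add: w_def)
  have q: "0 \<le> q" "q \<le> 1" using w m(1) pred by (auto simp: q_def w_def)
  have "q * w = cost (h m) - t" using w by (simp add: q_def)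
  moreover have "q * cost (h (m - 1)) + (1 - q) * cost (h m) = cost (h m) - q * w"
    by (simp add: w_def algebra_simps)
  ultimately have eq: "q * cost (h (m - 1)) + (1 - q) * cost (h m) = t" by simp
  show ?thesis
  proof (rule that[of m q "h (m - 1)" "h m"])
    show "h (m - 1) i = h m i" if "i \<noteq> m" for i using that by (auto simp: h_def)
  qed (use \<open>m \<noteq> 0\<close> m(2) q eq P lam in \<open>auto simp: h_def\<close>)
qed

lemma avg_split_one_sample:
  assumes "i0 \<in> {1..N}" and "\<And>i. i \<noteq> i0 \<Longrightarrow> a i = b i"
  shows "q * avg (\<lambda>i. g (a i)) + (1 - q) * avg (\<lambda>i. g (b i))
    = 1 / real N * (\<Sum>i\<in>{1..N} - {i0}. g (a i)) + q / real N * g (a i0) + (1 - q) / real N * g (b i0)"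
proof -
  let ?R = "\<Sum>i\<in>{1..N} - {i0}. g (a i)"
  have "(\<Sum>i=1..N. g (a i)) = g (a i0) + ?R" using assms(1) by (simp add: sum.remove)
  moreover have "(\<Sum>i=1..N. g (b i)) = g (b i0) + ?R"
    using assms by (subst sum.remove[of _ i0]) (auto intro!: sum.cong)
  ultimately show ?thesis
    by (simp add: avg_def add_divide_distrib diff_divide_distrib algebra_simps)
qed

text \<open>
  The slack of the dual constraint, built from a Borel version of \<open>\<Psi>\<close> and set to \<open>1\<close> on the null set where
  that version may differ from \<open>\<Psi>\<close>, so that its zeros are genuine minimizers. As \<open>\<mu>\<close> attains the dual value, the
  mean slack of a coupling is \<open>\<lambda>\<close> times its excess cost over \<open>\<theta>^p\<close>.
\<close>
lemma worst_case_slack: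
  assumes wc: "worst_case p \<theta> \<nu> \<Psi> \<mu>" and dm: "dual_minimizer p \<theta> \<nu> \<Psi> lam"
  obtains s where "section_integrable \<mu> s" "\<And>\<xi> \<zeta>. \<zeta> \<in> centers \<Longrightarrow> 0 \<le> s \<xi> \<zeta>"
    and "\<And>\<xi> \<zeta>. \<zeta> \<in> centers \<Longrightarrow> s \<xi> \<zeta> = 0 \<Longrightarrow> lam * dist \<xi> \<zeta> powr p - \<Psi> \<xi> = phi lam \<zeta>"
    and "\<And>\<gamma>. \<gamma> \<in> couplings \<mu> \<nu> \<Longrightarrow>
      coupling_mean \<gamma> s = lam * (coupling_mean \<gamma> (\<lambda>\<xi> \<zeta>. dist \<xi> \<zeta> powr p) - \<theta> powr p)"
proof -
  have feas: "\<mu> \<in> feasible p \<theta> \<nu>"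
    and val: "ext_integral \<mu> (\<lambda>\<xi>. ereal (\<Psi> \<xi>)) = dual_value p \<theta> \<nu> \<Psi>"
    and "dual_value p \<theta> \<nu> \<Psi> < \<infinity>"
    using wc by (auto simp: worst_case_def strong_duality)
  note lam = dual_minimizer_value[OF dm this(3)]
  have int: "integrable (completion \<mu>) \<Psi>"
    by (rule integrable_if_ext_integral_finite[OF val[unfolded lam(2)]])
  then have mean: "integral\<^sup>L (completion \<mu>) \<Psi> = lam * \<theta> powr p - avg (\<lambda>i. phi lam (x i))"
    using val lam(2) by (simp add: ext_integral_eq_integral)
  have pr: "prob_space \<mu>" using feas by (simp add: feasible_def borel_prob_def)
  obtain \<Psi>' where \<Psi>': "\<Psi>' \<in> borel_measurable \<mu>" "AE \<xi> in \<mu>. \<Psi> \<xi> = \<Psi>' \<xi>"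
    using completion_ex_borel_measurable_real[OF borel_measurable_integrable[OF int]] by auto
  obtain Z where Z: "Z \<in> null_sets \<mu>" "{\<xi>\<in>space \<mu>. \<Psi> \<xi> \<noteq> \<Psi>' \<xi>} \<subseteq> Z"
    using \<Psi>'(2) by (auto elim!: AE_E simp: null_sets_def)
  have "space \<mu> = UNIV"
    using feas sets_eq_imp_space_eq[of \<mu> borel] by (auto simp: feasible_def borel_prob_def)
  then have Z': "\<Psi> \<xi> = \<Psi>' \<xi>" if "\<xi> \<notin> Z" for \<xi> using Z(2) that by auto
  have eqI: "integral\<^sup>L (completion \<mu>) \<Psi> = integral\<^sup>L (completion \<mu>) \<Psi>'"
    using AE_completion[OF \<Psi>'(2)] borel_measurable_integrable[OF int] measurable_completion[OF \<Psi>'(1)]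
    by (intro integral_cong_AE) auto
  have "integrable (completion \<mu>) \<Psi>'"
    using AE_completion[OF \<Psi>'(2)] int measurable_completion[OF \<Psi>'(1)]
    by (subst integrable_cong_AE[symmetric]) auto
  then have int': "integrable \<mu> \<Psi>'" using integrable_completion[OF \<Psi>'(1)] by simp
  have mean': "integral\<^sup>L \<mu> \<Psi>' = lam * \<theta> powr p - avg (\<lambda>i. phi lam (x i))"
    using mean eqI integral_completion[OF \<Psi>'(1)] by simp
  obtain \<gamma>0 where b: "section_integrable \<mu> (\<lambda>\<xi> \<zeta>. dist \<xi> \<zeta> powr p)"
    by (rule feasible_coupling_mean[OF feas zero_less_one])
  define s' where "s' \<xi> \<zeta> = lam * dist \<xi> \<zeta> powr p - \<Psi>' \<xi> - phi lam \<zeta>" for \<xi> \<zeta>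
  define s where "s \<xi> \<zeta> = (if \<xi> \<in> Z then 1 else s' \<xi> \<zeta>)" for \<xi> \<zeta>
  have s'int: "section_integrable \<mu> s'"
    unfolding s'_def
    by (intro section_integrable_diff section_integrable_cmult b section_integrable_fst int' section_integrable_center pr)
  have AEs: "AE \<xi> in \<mu>. s \<xi> \<zeta> = s' \<xi> \<zeta>" for \<zeta>
    using AE_not_in[OF Z(1)] by eventually_elim (simp add: s_def)
  have AEle: "AE \<xi> in \<mu>. s \<xi> \<zeta> \<le> s' \<xi> \<zeta>" "AE \<xi> in \<mu>. s' \<xi> \<zeta> \<le> s \<xi> \<zeta>" for \<zeta>
    using AEs[of \<zeta>] by (eventually_elim, simp)+
  have sint: "section_integrable \<mu> s"
    unfolding section_integrable_def
  proof
    fix \<zeta> assume "\<zeta> \<in> centers"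
    then have i: "integrable \<mu> (\<lambda>\<xi>. s' \<xi> \<zeta>)" using s'int by (simp add: section_integrable_def)
    have [measurable]: "Z \<in> sets \<mu>" "(\<lambda>\<xi>. s' \<xi> \<zeta>) \<in> borel_measurable \<mu>" using Z(1) i by auto
    have "(\<lambda>\<xi>. s \<xi> \<zeta>) \<in> borel_measurable \<mu>"
      unfolding s_def by measurable
    then show "integrable \<mu> (\<lambda>\<xi>. s \<xi> \<zeta>)"
      using i AEs[of \<zeta>] by (subst integrable_cong_AE[where g="\<lambda>\<xi>. s' \<xi> \<zeta>"]) auto
  qed
  have alt: "s \<xi> \<zeta> = lam * dist \<xi> \<zeta> powr p - \<Psi> \<xi> - phi lam \<zeta>" if "\<xi> \<notin> Z" for \<xi> \<zeta>
    using that Z'[OF that] by (simp add: s_def s'_def)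
  show ?thesis
  proof (rule that[OF sint])
    fix \<xi> \<zeta> assume "\<zeta> \<in> centers"
    then obtain i where "i \<in> {1..N}" "\<zeta> = x i" by (auto simp: centers_def)
    then show "0 \<le> s \<xi> \<zeta>"
      using phi_le[OF lam(1), of i \<xi>] alt[of \<xi> \<zeta>] by (cases "\<xi> \<in> Z") (auto simp: s_def)
    show "lam * dist \<xi> \<zeta> powr p - \<Psi> \<xi> = phi lam \<zeta>" if "s \<xi> \<zeta> = 0"
      using that alt[of \<xi> \<zeta>] by (cases "\<xi> \<in> Z") (auto simp: s_def)
  next
    fix \<gamma> assume g: "\<gamma> \<in> couplings \<mu> \<nu>"
    have "coupling_mean \<gamma> s = coupling_mean \<gamma> s'"
    proof (rule antisym)
      show "coupling_mean \<gamma> s \<le> coupling_mean \<gamma> s'"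
        by (rule coupling_mean_mono[OF g sint s'int]) (simp add: AEle)
      show "coupling_mean \<gamma> s' \<le> coupling_mean \<gamma> s"
        by (rule coupling_mean_mono[OF g s'int sint]) (simp add: AEle)
    qed
    also have "\<dots> = lam * coupling_mean \<gamma> (\<lambda>\<xi> \<zeta>. dist \<xi> \<zeta> powr p) - integral\<^sup>L \<mu> \<Psi>' - avg (\<lambda>i. phi lam (x i))"
      unfolding s'_def
      by (simp add: coupling_mean_diff[OF g section_integrable_diff[OF section_integrable_cmult[OF b] section_integrable_fst[OF int']]
            section_integrable_center[OF pr]]
          coupling_mean_diff[OF g section_integrable_cmult[OF b] section_integrable_fst[OF int']]
          coupling_mean_cmult[OF g] coupling_mean_center[OF g] coupling_mean_fst[OF g int'])
    finally show "coupling_mean \<gamma> s = lam * (coupling_mean \<gamma> (\<lambda>\<xi> \<zeta>. dist \<xi> \<zeta> powr p) - \<theta> powr p)"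
      by (simp add: mean' right_diff_distrib)
  qed
qed

text \<open>
  Couplings with cost close to \<open>\<theta>^p\<close> have small mean slack. This yields a configuration of minimizers of cost at most
  \<open>\<theta>^p\<close>. If \<open>\<lambda> > 0\<close>, nonnegativity of the slack shows that no coupling costs less than \<open>\<theta>^p\<close>, and the same argument
  with the sign of the cost reversed yields one of cost at least \<open>\<theta>^p\<close>. On minimizers the payoff is an affine
  function of the cost with slope \<open>\<lambda>\<close>, hence a mixture of minimizers that exhausts the budget, or just respects it if
  \<open>\<lambda> = 0\<close>, is optimal.
\<close>
lemma worst_case_structure:
  assumes wc: "worst_case p \<theta> \<nu> \<Psi> \<mu>" and dm: "dual_minimizer p \<theta> \<nu> \<Psi> lam"
  obtains i0 q a b where "i0 \<in> {1..N}" "0 \<le> q" "q \<le> 1" "\<And>i. i \<noteq> i0 \<Longrightarrow> a i = b i"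
    and "\<And>i. i \<in> {1..N} \<Longrightarrow> is_arg_min (\<lambda>\<xi>. lam * dist \<xi> (x i) powr p - \<Psi> \<xi>) (\<lambda>_. True) (a i)"
    and "\<And>i. i \<in> {1..N} \<Longrightarrow> is_arg_min (\<lambda>\<xi>. lam * dist \<xi> (x i) powr p - \<Psi> \<xi>) (\<lambda>_. True) (b i)"
    and "worst_case p \<theta> \<nu> \<Psi> (layered (bernoulli_pmf q) (\<lambda>k. if k then a else b))"
proof -
  have feas: "\<mu> \<in> feasible p \<theta> \<nu>" and fin: "dual_value p \<theta> \<nu> \<Psi> < \<infinity>"
    using wc by (auto simp: worst_case_def strong_duality)
  have pr: "prob_space \<mu>" using feas by (simp add: feasible_def borel_prob_def)
  have lam0: "0 \<le> lam" using dm by (simp add: dual_minimizer_iff)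
  note lam = dual_minimizer_value[OF dm fin]
  let ?b = "\<lambda>\<xi> \<zeta>. dist \<xi> \<zeta> powr p"
  obtain s where s: "section_integrable \<mu> s" "\<And>\<xi> \<zeta>. \<zeta> \<in> centers \<Longrightarrow> 0 \<le> s \<xi> \<zeta>"
    "\<And>\<xi> \<zeta>. \<zeta> \<in> centers \<Longrightarrow> s \<xi> \<zeta> = 0 \<Longrightarrow> lam * ?b \<xi> \<zeta> - \<Psi> \<xi> = phi lam \<zeta>"
    "\<And>\<gamma>. \<gamma> \<in> couplings \<mu> \<nu> \<Longrightarrow> coupling_mean \<gamma> s = lam * (coupling_mean \<gamma> ?b - \<theta> powr p)"
    by (rule worst_case_slack[OF wc dm]) blast
  obtain \<gamma>0 where b: "section_integrable \<mu> ?b"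
    by (rule feasible_coupling_mean[OF feas zero_less_one])
  have approx: "\<exists>\<gamma>\<in>couplings \<mu> \<nu>. coupling_mean \<gamma> s \<le> \<delta> \<and> coupling_mean \<gamma> ?b \<le> \<theta> powr p + \<delta>"
    if \<delta>: "0 < \<delta>" for \<delta>
  proof -
    define e where "e = \<delta> / (lam + 1)"
    have e: "0 < e" "e \<le> \<delta>" "lam * e \<le> \<delta>"
      using \<delta> lam0 by (auto simp: e_def field_simps)
    obtain \<gamma> where g: "\<gamma> \<in> couplings \<mu> \<nu>" "coupling_mean \<gamma> ?b \<le> \<theta> powr p + e"
      by (rule feasible_coupling_mean[OF feas e(1)])
    have "coupling_mean \<gamma> s \<le> lam * e"
      unfolding s(4)[OF g(1)] using g(2) lam0 by (intro mult_left_mono) auto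
    then show ?thesis using g e by (intro bexI[of _ \<gamma>]) auto
  qed
  obtain lo where lo: "\<And>i. i \<in> {1..N} \<Longrightarrow> s (lo i) (x i) = 0" "cost lo \<le> \<theta> powr p"
    using select_configuration[OF pr s(1) b s(2) approx] unfolding cost_def by blast
  have "\<exists>hi. lam \<noteq> 0 \<longrightarrow> (\<forall>i\<in>{1..N}. s (hi i) (x i) = 0) \<and> \<theta> powr p \<le> cost hi"
  proof (cases "lam = 0")
    case False
    have approx': "\<exists>\<gamma>\<in>couplings \<mu> \<nu>. coupling_mean \<gamma> s \<le> \<delta> \<and> coupling_mean \<gamma> (\<lambda>\<xi> \<zeta>. (-1) * ?b \<xi> \<zeta>) \<le> - (\<theta> powr p) + \<delta>"
      if \<delta>: "0 < \<delta>" for \<delta>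
    proof -
      obtain \<gamma> where g: "\<gamma> \<in> couplings \<mu> \<nu>" "coupling_mean \<gamma> s \<le> \<delta>" using approx[OF \<delta>] by blast
      have "0 \<le> coupling_mean \<gamma> s"
        using coupling_mean_mono[OF g(1) section_integrable_center[OF pr, of "\<lambda>_. 0"] s(1)] s(2)
          coupling_mean_center[OF g(1), of "\<lambda>_. 0"] by (simp add: avg_const)
      then have "\<theta> powr p \<le> coupling_mean \<gamma> ?b"
        using False lam0 unfolding s(4)[OF g(1)] by (simp add: zero_le_mult_iff)
      then show ?thesis using g \<delta> coupling_mean_cmult[OF g(1), of "-1" ?b] by (intro bexI[of _ \<gamma>]) auto
    qed
    obtain hi where "\<And>i. i \<in> {1..N} \<Longrightarrow> s (hi i) (x i) = 0"
      "avg (\<lambda>i. (-1) * ?b (hi i) (x i)) \<le> - (\<theta> powr p)"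
      using select_configuration[OF pr s(1) section_integrable_cmult[OF b] s(2) approx'] by blast
    then show ?thesis unfolding avg_cmult cost_def by (intro exI[of _ hi]) auto
  qed simp
  then obtain hi where hi: "lam \<noteq> 0 \<Longrightarrow> (\<forall>i\<in>{1..N}. s (hi i) (x i) = 0)" "lam \<noteq> 0 \<Longrightarrow> \<theta> powr p \<le> cost hi"
    by blast
  obtain i0 q a c where st: "i0 \<in> {1..N}" "0 \<le> q" "q \<le> 1" "\<And>i. i \<noteq> i0 \<Longrightarrow> a i = c i"
    and A: "\<And>i. i \<in> {1..N} \<Longrightarrow> s (a i) (x i) = 0" "\<And>i. i \<in> {1..N} \<Longrightarrow> s (c i) (x i) = 0"
    and le: "q * cost a + (1 - q) * cost c \<le> \<theta> powr p"
    and eq: "lam * (q * cost a + (1 - q) * cost c) = lam * \<theta> powr p"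
    by (rule split_one_sample[of lo "\<theta> powr p" lam hi "\<lambda>i y. s y (x i) = 0"]) (use lo hi in blast)+
  have argmin: "is_arg_min (\<lambda>\<xi>. lam * ?b \<xi> (x i) - \<Psi> \<xi>) (\<lambda>_. True) y"
    if "i \<in> {1..N}" "s y (x i) = 0" for i y
    using s(3)[OF center_in[OF that(1)] that(2)] phi_le[OF lam(1) that(1)]
    by (simp add: is_arg_min_linorder)
  have pay: "payoff \<xi> = lam * cost \<xi> - avg (\<lambda>i. phi lam (x i))"
    if "\<And>i. i \<in> {1..N} \<Longrightarrow> s (\<xi> i) (x i) = 0" for \<xi>
  proof -
    have "lam * cost \<xi> - payoff \<xi> = avg (\<lambda>i. phi lam (x i))"
      unfolding avg_slack[symmetric] by (rule avg_cong) (use s(3) that in simp)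
    then show ?thesis by simp
  qed
  have "q * payoff a + (1 - q) * payoff c
      = lam * (q * cost a + (1 - q) * cost c) - avg (\<lambda>i. phi lam (x i))"
    unfolding pay[of a, OF A(1), simplified] pay[of c, OF A(2), simplified] by (simp add: algebra_simps)
  then have val: "q * payoff a + (1 - q) * payoff c = lam * \<theta> powr p - avg (\<lambda>i. phi lam (x i))"
    using eq by simp
  let ?\<mu> = "layered (bernoulli_pmf q) (\<lambda>k. if k then a else c)"
  have finQ: "finite (set_pmf (bernoulli_pmf q))" by (rule finite_subset[OF subset_UNIV]) simp
  have "?\<mu> \<in> feasible p \<theta> \<nu>"
    using le st by (intro layered_feasible[OF finQ]) (simp add: mult.commute)
  moreover have "ext_integral ?\<mu> (\<lambda>\<xi>. ereal (\<Psi> \<xi>)) = dual_value p \<theta> \<nu> \<Psi>"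
    unfolding layered_ext_integral[OF finQ] lam(2) val[symmetric] using st by (simp add: mult.commute)
  ultimately have "worst_case p \<theta> \<nu> \<Psi> ?\<mu>"
    using fin by (simp add: worst_case_def strong_duality)
  then show ?thesis using that[of i0 q a c] st A argmin by auto
qed

section \<open>Robust approximation\<close>

lemma robust_objective:
  assumes "K \<ge> 1"
  shows "1 / (real N * real K) * (\<Sum>i=1..N. \<Sum>k=1..K. g (\<xi> i k) i)
    = (1 / real K * (\<Sum>k=1..K. avg (\<lambda>i. g (\<xi> i k) i)) :: real)"
  by (subst sum.swap) (simp add: avg_def sum_distrib_left[symmetric] sum_divide_distrib[symmetric])

lemma robust_set_iff:
  "K \<ge> 1 \<Longrightarrow> \<xi> \<in> robust_set p \<theta> N x K \<longleftrightarrow> 1 / real K * (\<Sum>k=1..K. cost (\<lambda>i. \<xi> i k)) \<le> \<theta> powr p"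
  using robust_objective[of K "\<lambda>y i. dist y (x i) powr p" \<xi>] by (simp add: robust_set_def cost_def)

lemma robust_value_eq:
  "K \<ge> 1 \<Longrightarrow> robust_value p \<theta> N x \<Psi> K =
    (SUP \<xi>\<in>robust_set p \<theta> N x K. ereal (1 / real K * (\<Sum>k=1..K. payoff (\<lambda>i. \<xi> i k))))"
  using robust_objective[of K "\<lambda>y i. \<Psi> y"] by (simp add: robust_value_def payoff_def)

lemma robust_value_upper:
  assumes "K \<ge> 1" and "1 / real K * (\<Sum>k=1..K. cost (\<xi> k)) \<le> \<theta> powr p"
  shows "ereal (1 / real K * (\<Sum>k=1..K. payoff (\<xi> k))) \<le> robust_value p \<theta> N x \<Psi> K"
  unfolding robust_value_eq[OF assms(1)]
  by (rule SUP_upper2[of "\<lambda>i k. \<xi> k i"]) (use assms in \<open>auto simp: robust_set_iff\<close>)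

lemma robust_le_primal:
  assumes K: "K \<ge> 1"
  shows "robust_value p \<theta> N x \<Psi> K \<le> primal_value p \<theta> \<nu> \<Psi>"
  unfolding robust_value_eq[OF K]
proof (rule SUP_least)
  fix \<xi> assume "\<xi> \<in> robust_set p \<theta> N x K"
  then have le: "1 / real K * (\<Sum>k=1..K. cost (\<lambda>i. \<xi> i k)) \<le> \<theta> powr p"
    using K by (simp add: robust_set_iff)
  let ?Q = "pmf_of_set {1..K}"
  have set: "set_pmf ?Q = {1..K}" using K by (intro set_pmf_of_set) auto
  have E: "measure_pmf.expectation ?Q g = 1 / real K * (\<Sum>k=1..K. g k)" for g :: "nat \<Rightarrow> real"
    using K by (subst integral_pmf_of_set) auto
  have fin: "finite (set_pmf ?Q)" unfolding set by simp
  show "ereal (1 / real K * (\<Sum>k=1..K. payoff (\<lambda>i. \<xi> i k))) \<le> primal_value p \<theta> \<nu> \<Psi>"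
    using layered_le_primal[OF fin, of "\<lambda>k i. \<xi> i k"] le unfolding E by simp
qed

text \<open>
  Take a mixture of weight \<open>\<alpha>\<close> that is optimal up to \<open>1/K\<close>, write \<open>\<alpha> K = m + f\<close> with \<open>0 \<le> f \<le> 1\<close> and \<open>m < K\<close>, and use
  \<open>m\<close> layers \<open>\<xi>\<close>, \<open>K - 1 - m\<close> layers \<open>\<eta>\<close> and one layer \<open>x\<close>. The loss is \<open>1/K\<close> times
  \<open>f u(\<xi>) + (1 - f) u(\<eta>) - u(x)\<close>, so this has to be bounded independently of \<open>K\<close>. The excess \<open>\<lambda> c - u - F\<close>, where \<open>F\<close> is the average of
  \<open>\<Phi>(\<lambda>, x i)\<close>, has \<open>\<alpha>\<close>-mean at most \<open>1/K\<close>, and \<open>f \<le> K \<alpha>\<close>, \<open>1 - f \<le> K (1 - \<alpha>)\<close>, so its \<open>f\<close>-mean is at most \<open>1\<close>. Since \<open>\<Phi>(\<lambda>', x i)\<close> is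
  also finite, the excess grows at least like \<open>(\<lambda> - \<lambda>') c\<close>, which bounds the \<open>f\<close>-mean of the cost and then of the
  payoff.
\<close>
lemma robust_approximation:
  assumes dm: "dual_minimizer p \<theta> \<nu> \<Psi> lam" and fin': "Phi_finite lam'" and lam': "0 \<le> lam'" "lam' < lam"
  obtains C where "\<And>K. K \<ge> 1 \<Longrightarrow>
    primal_value p \<theta> \<nu> \<Psi> \<le> robust_value p \<theta> N x \<Psi> K + ereal (C / real K)"
proof -
  define t where "t = \<theta> powr p"
  have "dual_value p \<theta> \<nu> \<Psi> \<le> dual_objective p \<theta> \<nu> \<Psi> lam'"
    unfolding dual_value_def using lam' by (intro INF_lower) simp
  then have "dual_value p \<theta> \<nu> \<Psi> < \<infinity>" using fin' by (auto simp: dual_objective_eq)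
  note lam = dual_minimizer_value[OF dm this]
  define F F' where "F = avg (\<lambda>i. phi lam (x i))" and "F' = avg (\<lambda>i. phi lam' (x i))"
  define V where "V = lam * t - F"
  have V: "primal_value p \<theta> \<nu> \<Psi> = ereal V" "mixture_value = ereal V"
    using lam(2) by (simp_all add: strong_duality V_def t_def F_def)
  define excess where "excess \<xi> = lam * cost \<xi> - payoff \<xi> - F" for \<xi>
  define B where "B = F - F'"
  have ex0: "0 \<le> excess \<xi>" for \<xi> using payoff_le[OF lam(1), of \<xi>] by (simp add: excess_def F_def)
  have coercive: "(lam - lam') * cost \<xi> \<le> excess \<xi> + B" for \<xi>
    using payoff_le[OF fin', of \<xi>] by (simp add: excess_def F'_def B_def left_diff_distrib)
  define U where "U = lam * ((1 + B) / (lam - lam')) - F"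
  define C where "C = 1 + U - payoff x"
  have "primal_value p \<theta> \<nu> \<Psi> \<le> robust_value p \<theta> N x \<Psi> K + ereal (C / real K)" if K: "K \<ge> 1" for K
  proof -
    have "ereal (V - 1 / real K) < mixture_value" using K by (simp add: V)
    then obtain \<alpha> \<xi> \<eta> where \<alpha>: "0 \<le> \<alpha>" "\<alpha> \<le> 1"
      and budget: "\<alpha> * cost \<xi> + (1 - \<alpha>) * cost \<eta> \<le> t"
      and val: "V - 1 / real K < \<alpha> * payoff \<xi> + (1 - \<alpha>) * payoff \<eta>"
      unfolding mixture_value_def less_Sup_iff by (auto simp: t_def)
    \<comment> \<open>the cap at \<open>K - 1\<close> keeps one layer free for \<open>x\<close> also when \<open>\<alpha> = 1\<close>, where \<open>f = 1\<close>\<close>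
    define n where "n = nat \<lfloor>\<alpha> * real K\<rfloor>"
    define m where "m = min n (K - 1)"
    define f where "f = \<alpha> * real K - real m"
    have mK: "m < K" using K by (simp add: m_def min_less_iff_disj)
    have "0 \<le> \<alpha> * real K" using \<alpha>(1) by simp
    then have "real n = of_int \<lfloor>\<alpha> * real K\<rfloor>" by (simp add: n_def)
    then have n: "real n \<le> \<alpha> * real K" "\<alpha> * real K < real n + 1" by linarith+
    have aK: "\<alpha> * real K \<le> real K" using \<alpha> by (simp add: mult_left_le_one_le)
    have f: "0 \<le> f" "f \<le> 1"
    proof -
      have "real m \<le> real n" "m = n \<or> real m = real K - 1"
        using K by (auto simp: m_def min_def of_nat_diff)
      then show "0 \<le> f" "f \<le> 1" using n aK by (auto simp: f_def)
    qed
    have fa: "f \<le> real K * \<alpha>" by (simp add: f_def mult.commute)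
    have fb: "1 - f \<le> real K * (1 - \<alpha>)" using mK by (simp add: f_def algebra_simps)
    have "\<alpha> * excess \<xi> + (1 - \<alpha>) * excess \<eta>
        = lam * (\<alpha> * cost \<xi> + (1 - \<alpha>) * cost \<eta>) - (\<alpha> * payoff \<xi> + (1 - \<alpha>) * payoff \<eta>) - F"
      by (simp add: excess_def algebra_simps)
    also have "\<dots> \<le> lam * t - (V - 1 / real K) - F"
      using lam' budget val by (intro diff_mono mult_left_mono) auto
    also have "\<dots> = 1 / real K" by (simp add: V_def)
    finally have small: "real K * (\<alpha> * excess \<xi> + (1 - \<alpha>) * excess \<eta>) \<le> 1"
      using K by (simp add: field_simps)
    have "f * excess \<xi> + (1 - f) * excess \<eta> \<le> real K * \<alpha> * excess \<xi> + real K * (1 - \<alpha>) * excess \<eta>"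
      by (intro add_mono mult_right_mono fa fb ex0)
    also have "\<dots> \<le> 1" using small by (simp add: algebra_simps)
    finally have exf: "f * excess \<xi> + (1 - f) * excess \<eta> \<le> 1" .
    have "(lam - lam') * (f * cost \<xi> + (1 - f) * cost \<eta>)
        = f * ((lam - lam') * cost \<xi>) + (1 - f) * ((lam - lam') * cost \<eta>)"
      by (simp add: algebra_simps)
    also have "\<dots> \<le> f * (excess \<xi> + B) + (1 - f) * (excess \<eta> + B)"
      using f by (intro add_mono mult_left_mono coercive) auto
    also have "\<dots> = f * excess \<xi> + (1 - f) * excess \<eta> + B" by (simp add: algebra_simps)
    finally have "f * cost \<xi> + (1 - f) * cost \<eta> \<le> (1 + B) / (lam - lam')"
      using exf lam' by (simp add: pos_le_divide_eq mult.commute)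
    then have "lam * (f * cost \<xi> + (1 - f) * cost \<eta>) \<le> lam * ((1 + B) / (lam - lam'))"
      using lam' by (intro mult_left_mono) auto
    moreover have "f * payoff \<xi> + (1 - f) * payoff \<eta>
        = lam * (f * cost \<xi> + (1 - f) * cost \<eta>) - F - (f * excess \<xi> + (1 - f) * excess \<eta>)"
      by (simp add: excess_def algebra_simps)
    moreover have "0 \<le> f * excess \<xi> + (1 - f) * excess \<eta>"
      using f ex0 by simp
    ultimately have pf: "f * payoff \<xi> + (1 - f) * payoff \<eta> \<le> U"
      by (simp add: U_def)
    define \<omega> where "\<omega> k = (if k \<le> m then \<xi> else if k < K then \<eta> else x)" for k
    have sums: "(\<Sum>k=1..K. g (\<omega> k)) = real K * (\<alpha> * g \<xi> + (1 - \<alpha>) * g \<eta>) - (f * g \<xi> + (1 - f) * g \<eta>) + g x"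
      for g :: "(nat \<Rightarrow> 'a) \<Rightarrow> real"
      unfolding \<omega>_def sum_three_layers[OF mK, of g] by (simp add: f_def algebra_simps)
    have "0 \<le> f * cost \<xi> + (1 - f) * cost \<eta>" using f cost_nonneg by simp
    then have "(\<Sum>k=1..K. cost (\<omega> k)) \<le> real K * (\<alpha> * cost \<xi> + (1 - \<alpha>) * cost \<eta>)"
      unfolding sums[of cost] cost_center by linarith
    also have "\<dots> \<le> real K * t" using budget by (intro mult_left_mono) auto
    finally have "1 / real K * (\<Sum>k=1..K. cost (\<omega> k)) \<le> t"
      using K by (simp add: pos_divide_le_eq mult.commute)
    then have up: "ereal (1 / real K * (\<Sum>k=1..K. payoff (\<omega> k))) \<le> robust_value p \<theta> N x \<Psi> K"
      by (intro robust_value_upper K) (simp add: t_def)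
    have "real K * (V - 1 / real K) \<le> real K * (\<alpha> * payoff \<xi> + (1 - \<alpha>) * payoff \<eta>)"
      using val by (intro mult_left_mono) auto
    then have "real K * V - 1 \<le> real K * (\<alpha> * payoff \<xi> + (1 - \<alpha>) * payoff \<eta>)"
      using K by (simp add: right_diff_distrib)
    then have "real K * V - C \<le> (\<Sum>k=1..K. payoff (\<omega> k))"
      unfolding sums[of payoff] C_def using pf by linarith
    then have "V \<le> 1 / real K * (\<Sum>k=1..K. payoff (\<omega> k)) + C / real K"
      using K by (simp add: field_simps)
    then have "ereal V \<le> ereal (1 / real K * (\<Sum>k=1..K. payoff (\<omega> k))) + ereal (C / real K)"
      by simp
    also have "\<dots> \<le> robust_value p \<theta> N x \<Psi> K + ereal (C / real K)"
      by (intro add_right_mono up)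
    finally show ?thesis by (simp add: V)
  qed
  then show ?thesis using that by blast
qed

section \<open>Convex spaces and concave objectives\<close>

text \<open>
  The primal value is already the supremum over mixtures of two configurations. Replacing the two positions of a
  sample by their barycentre does not raise the cost, by convexity of the metric and of \<open>t powr p\<close>, and does not lower the
  payoff, by concavity.
\<close>
lemma convex_space_robust_value:
  fixes e :: "'a \<Rightarrow> 'b::real_vector"
  assumes e: "convex_space e" and conc: "concave_on (range e) (\<Psi> \<circ> inv e)"
  shows "robust_value p \<theta> N x \<Psi> 1 = primal_value p \<theta> \<nu> \<Psi>"
proof (rule antisym)
  show "robust_value p \<theta> N x \<Psi> 1 \<le> primal_value p \<theta> \<nu> \<Psi>" by (rule robust_le_primal) simp
  have inj: "inj e" and conv: "\<And>\<zeta>. convex_on (range e) (\<lambda>v. dist (inv e v) \<zeta>)"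
    using e by (auto simp: convex_space_def)
  show "primal_value p \<theta> \<nu> \<Psi> \<le> robust_value p \<theta> N x \<Psi> 1"
    unfolding strong_duality(1) strong_duality(2)[symmetric] mixture_value_def
  proof (rule Sup_least, clarify)
    fix \<alpha> \<xi> \<eta> assume \<alpha>: "0 \<le> \<alpha>" "\<alpha> \<le> 1" and le: "\<alpha> * cost \<xi> + (1 - \<alpha>) * cost \<eta> \<le> \<theta> powr p"
    define y where "y i = inv e (\<alpha> *\<^sub>R e (\<xi> i) + (1 - \<alpha>) *\<^sub>R e (\<eta> i))" for i
    have d: "dist (y i) (x i) powr p \<le> \<alpha> * dist (\<xi> i) (x i) powr p + (1 - \<alpha>) * dist (\<eta> i) (x i) powr p" for i
    proof -
      have "dist (y i) (x i) \<le> \<alpha> * dist (\<xi> i) (x i) + (1 - \<alpha>) * dist (\<eta> i) (x i)"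
        using conv[of "x i"] \<alpha> inj unfolding convex_on_def y_def by (auto simp: inv_f_f)
      then have "dist (y i) (x i) powr p \<le> (\<alpha> * dist (\<xi> i) (x i) + (1 - \<alpha>) * dist (\<eta> i) (x i)) powr p"
        using p by (intro powr_mono2) auto
      also have "\<dots> \<le> \<alpha> * dist (\<xi> i) (x i) powr p + (1 - \<alpha>) * dist (\<eta> i) (x i) powr p"
        using \<alpha> by (intro powr_convex_combination[OF p]) auto
      finally show ?thesis .
    qed
    have psi: "\<alpha> * \<Psi> (\<xi> i) + (1 - \<alpha>) * \<Psi> (\<eta> i) \<le> \<Psi> (y i)" for i
      using conc \<alpha> inj unfolding concave_on_iff y_def by (auto simp: inv_f_f)
    have "cost y \<le> \<alpha> * cost \<xi> + (1 - \<alpha>) * cost \<eta>"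
      unfolding cost_def avg_cmult[symmetric] avg_add[symmetric] by (intro avg_mono d)
    then have "cost y \<le> \<theta> powr p" using le by linarith
    then have "ereal (payoff y) \<le> robust_value p \<theta> N x \<Psi> 1"
      using robust_value_upper[of 1 "\<lambda>_. y"] by simp
    moreover have "\<alpha> * payoff \<xi> + (1 - \<alpha>) * payoff \<eta> \<le> payoff y"
      unfolding payoff_def avg_cmult[symmetric] avg_add[symmetric] by (intro avg_mono psi)
    ultimately show "ereal (\<alpha> * payoff \<xi> + (1 - \<alpha>) * payoff \<eta>) \<le> robust_value p \<theta> N x \<Psi> 1"
      by (meson ereal_less_eq(3) order_trans)
  qed
qed

end

section \<open>Strong duality, worst-case structure and robust approximation\<close>

theorem corollary2:
  fixes \<nu> :: "'a::polish_space measure" and x :: "nat \<Rightarrow> 'a" and N :: nat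
    and \<Psi> :: "'a \<Rightarrow> real" and p \<theta> :: real
  assumes "N \<ge> 1"
    and "\<nu> \<in> borel_prob"
    and "\<And>A. A \<in> sets borel \<Longrightarrow>
           measure \<nu> A = 1 / real N * (\<Sum>i=1..N. measure (return borel (x i)) A)"
    and "integrable (completion \<nu>) \<Psi>"
    and "1 \<le> p" and "0 < \<theta>"
  shows
    "(primal_value p \<theta> \<nu> \<Psi> = dual_value p \<theta> \<nu> \<Psi> \<and>
     dual_value p \<theta> \<nu> \<Psi> =
       (INF lam\<in>{0..}. ereal (lam * \<theta> powr p) -
          ereal (1 / real N) *
            (\<Sum>i=1..N. INF \<xi>. ereal (lam * dist \<xi> (x i) powr p - \<Psi> \<xi>)))) \<and>

     ((\<exists>\<mu>. worst_case p \<theta> \<nu> \<Psi> \<mu>) \<longrightarrow>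
     (\<exists>lam. dual_minimizer p \<theta> \<nu> \<Psi> lam) \<and>
     (\<forall>lam. dual_minimizer p \<theta> \<nu> \<Psi> lam \<longrightarrow>
       (\<exists>\<mu> S i0 p0 \<xi> \<xi>lo \<xi>up.
          worst_case p \<theta> \<nu> \<Psi> \<mu> \<and>
          finite S \<and> card S \<le> N + 1 \<and> measure \<mu> S = 1 \<and>
          i0 \<in> {1..N} \<and> p0 \<in> {0..1} \<and>
          (\<forall>A\<in>sets borel.
             measure \<mu> A =
               1 / real N * (\<Sum>i\<in>{1..N} - {i0}. measure (return borel (\<xi> i)) A) +
               p0 / real N * measure (return borel \<xi>lo) A +
               (1 - p0) / real N * measure (return borel \<xi>up) A) \<and>
          is_arg_min (\<lambda>\<xi>. lam * dist \<xi> (x i0) powr p - \<Psi> \<xi>) (\<lambda>_. True) \<xi>lo \<and>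
          is_arg_min (\<lambda>\<xi>. lam * dist \<xi> (x i0) powr p - \<Psi> \<xi>) (\<lambda>_. True) \<xi>up \<and>
          (\<forall>i\<in>{1..N} - {i0}.
             is_arg_min (\<lambda>\<xi>. lam * dist \<xi> (x i) powr p - \<Psi> \<xi>) (\<lambda>_. True) (\<xi> i))))) \<and>

     (\<forall>\<zeta>0 L M. 0 \<le> L \<and> 0 \<le> M \<and> (\<forall>\<xi>. \<bar>\<Psi> \<xi> - \<Psi> \<zeta>0\<bar> < L * dist \<xi> \<zeta>0 powr p + M) \<longrightarrow>
       (\<forall>lam. dual_minimizer p \<theta> \<nu> \<Psi> lam \<and> growth_rate p \<nu> \<Psi> < ereal lam \<longrightarrow>
          (\<exists>D::real. \<forall>K\<ge>1.
             robust_value p \<theta> N x \<Psi> K \<le> primal_value p \<theta> \<nu> \<Psi> \<and>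
             (0 < L \<longrightarrow>
                primal_value p \<theta> \<nu> \<Psi>
                  \<le> robust_value p \<theta> N x \<Psi> K + ereal ((L * D + M) / (real N * real K))))) \<and>
       (\<forall>e :: 'a \<Rightarrow> 'b::real_vector.
          convex_space e \<and> concave_on (range e) (\<Psi> \<circ> inv e) \<longrightarrow>
          robust_value p \<theta> N x \<Psi> 1 = primal_value p \<theta> \<nu> \<Psi> \<and>
          primal_value p \<theta> \<nu> \<Psi> = dual_value p \<theta> \<nu> \<Psi>))"
proof -
  interpret empirical_dro \<nu> x N \<Psi> p \<theta>
    using assms by unfold_locales (auto intro: empirical_measure_eq_distr)
  have duality: "primal_value p \<theta> \<nu> \<Psi> = dual_value p \<theta> \<nu> \<Psi>"
    by (rule strong_duality(1))
  have explicit: "dual_value p \<theta> \<nu> \<Psi> =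
       (INF lam\<in>{0..}. ereal (lam * \<theta> powr p) -
          ereal (1 / real N) *
            (\<Sum>i=1..N. INF \<xi>. ereal (lam * dist \<xi> (x i) powr p - \<Psi> \<xi>)))"
    unfolding dual_value_def by (rule INF_cong[OF refl dual_objective_explicit])
  have split_form: "\<exists>\<mu> S i0 p0 \<xi> \<xi>lo \<xi>up.
          worst_case p \<theta> \<nu> \<Psi> \<mu> \<and>
          finite S \<and> card S \<le> N + 1 \<and> measure \<mu> S = 1 \<and>
          i0 \<in> {1..N} \<and> p0 \<in> {0..1} \<and>
          (\<forall>A\<in>sets borel.
             measure \<mu> A =
               1 / real N * (\<Sum>i\<in>{1..N} - {i0}. measure (return borel (\<xi> i)) A) +
               p0 / real N * measure (return borel \<xi>lo) A +
               (1 - p0) / real N * measure (return borel \<xi>up) A) \<and>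
          is_arg_min (\<lambda>\<xi>. lam * dist \<xi> (x i0) powr p - \<Psi> \<xi>) (\<lambda>_. True) \<xi>lo \<and>
          is_arg_min (\<lambda>\<xi>. lam * dist \<xi> (x i0) powr p - \<Psi> \<xi>) (\<lambda>_. True) \<xi>up \<and>
          (\<forall>i\<in>{1..N} - {i0}.
             is_arg_min (\<lambda>\<xi>. lam * dist \<xi> (x i) powr p - \<Psi> \<xi>) (\<lambda>_. True) (\<xi> i))"
    if wc: "worst_case p \<theta> \<nu> \<Psi> \<mu>" and dm: "dual_minimizer p \<theta> \<nu> \<Psi> lam" for \<mu> lam
  proof -
    obtain i0 q a b where i0: "i0 \<in> {1..N}" and q: "0 \<le> q" "q \<le> 1"
      and ab: "\<And>i. i \<noteq> i0 \<Longrightarrow> a i = b i"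
      and am: "\<And>i. i \<in> {1..N} \<Longrightarrow> is_arg_min (\<lambda>\<xi>. lam * dist \<xi> (x i) powr p - \<Psi> \<xi>) (\<lambda>_. True) (a i)"
      and bm: "\<And>i. i \<in> {1..N} \<Longrightarrow> is_arg_min (\<lambda>\<xi>. lam * dist \<xi> (x i) powr p - \<Psi> \<xi>) (\<lambda>_. True) (b i)"
      and wc': "worst_case p \<theta> \<nu> \<Psi> (layered (bernoulli_pmf q) (\<lambda>k. if k then a else b))"
      by (rule worst_case_structure[OF wc dm]) blast
    let ?\<mu> = "layered (bernoulli_pmf q) (\<lambda>k. if k then a else b)"
    let ?S = "insert (b i0) (a ` {1..N})"
    have fin: "finite (set_pmf (bernoulli_pmf q))" by (rule finite_subset[OF subset_UNIV]) simp
    have meas: "measure ?\<mu> A = q * avg (\<lambda>i. indicator A (a i)) + (1 - q) * avg (\<lambda>i. indicator A (b i))"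
      if "A \<in> sets borel" for A
      using measure_layered[OF fin that, of "\<lambda>k. if k then a else b"] q by (simp add: mult.commute)
    have "card (a ` {1..N}) \<le> N" using card_image_le[of "{1..N}" a] by simp
    then have card: "card ?S \<le> N + 1" using card_insert_le_m1[of "N + 1" "a ` {1..N}" "b i0"] by simp
    have "?S \<in> sets borel" by (intro borel_closed finite_imp_closed) simp
    moreover have "avg (\<lambda>i. indicator ?S (a i)) = 1"
      using avg_cong[of "\<lambda>i. indicator ?S (a i)" "\<lambda>i. 1"] by (simp add: avg_const)
    moreover have "avg (\<lambda>i. indicator ?S (b i)) = 1"
    proof -
      have "b i \<in> ?S" if "i \<in> {1..N}" for i using ab[of i] that by (cases "i = i0") (force intro: image_eqI[of _ a i])+
      then show ?thesis
        using avg_cong[of "\<lambda>i. indicator ?S (b i)" "\<lambda>i. 1"] by (simp add: avg_const)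
    qed
    ultimately have "measure ?\<mu> ?S = 1" by (simp add: meas)
    moreover have "\<forall>A\<in>sets borel. measure ?\<mu> A =
               1 / real N * (\<Sum>i\<in>{1..N} - {i0}. measure (return borel (a i)) A) +
               q / real N * measure (return borel (a i0)) A +
               (1 - q) / real N * measure (return borel (b i0)) A"
    proof
      fix A :: "'a set" assume A: "A \<in> sets borel"
      show "measure ?\<mu> A =
               1 / real N * (\<Sum>i\<in>{1..N} - {i0}. measure (return borel (a i)) A) +
               q / real N * measure (return borel (a i0)) A +
               (1 - q) / real N * measure (return borel (b i0)) A"
        unfolding meas[OF A] measure_return[OF A] by (rule avg_split_one_sample[OF i0 ab])
    qed
    ultimately show ?thesis
      using wc' card i0 q am bm
      by (intro exI[of _ ?\<mu>] exI[of _ ?S] exI[of _ i0] exI[of _ q] exI[of _ a] exI[of _ "a i0"]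
          exI[of _ "b i0"]) auto
  qed
  have approximation: "\<exists>D::real. \<forall>K\<ge>1.
             robust_value p \<theta> N x \<Psi> K \<le> primal_value p \<theta> \<nu> \<Psi> \<and>
             (0 < L \<longrightarrow>
                primal_value p \<theta> \<nu> \<Psi>
                  \<le> robust_value p \<theta> N x \<Psi> K + ereal ((L * D + M) / (real N * real K)))"
    if dm: "dual_minimizer p \<theta> \<nu> \<Psi> lam" and growth: "growth_rate p \<nu> \<Psi> < ereal lam"
    for L M lam :: real
  proof -
    obtain lam' where lam': "0 \<le> lam'" "lam' < lam" "Phi_finite lam'"
      using growth unfolding growth_rate_def Inf_less_iff
      by (auto simp: ext_integral_Phi split: if_splits)
    obtain C where C: "\<And>K. K \<ge> 1 \<Longrightarrow>
        primal_value p \<theta> \<nu> \<Psi> \<le> robust_value p \<theta> N x \<Psi> K + ereal (C / real K)"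
      by (rule robust_approximation[OF dm lam'(3,1,2)]) blast
    \<comment> \<open>chosen so that \<open>L D + M = N C\<close>, which uses \<open>L > 0\<close>\<close>
    define D where "D = (real N * C - M) / L"
    have "(L * D + M) / (real N * real K) = C / real K" if "0 < L" for K
      using that N by (simp add: D_def)
    then show ?thesis using C robust_le_primal by (intro exI[of _ D]) auto
  qed
  have convex: "robust_value p \<theta> N x \<Psi> 1 = primal_value p \<theta> \<nu> \<Psi>"
    if "convex_space e" "concave_on (range e) (\<Psi> \<circ> inv e)" for e :: "'a \<Rightarrow> 'b"
    using that by (rule convex_space_robust_value)
  have minimizer: "\<exists>lam. dual_minimizer p \<theta> \<nu> \<Psi> lam" if "worst_case p \<theta> \<nu> \<Psi> \<mu>" for \<mu>
    using that by (intro dual_minimizer_exists) (simp add: worst_case_def)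
  show ?thesis
    apply (intro conjI allI impI)
    subgoal by (rule duality)
    subgoal by (rule explicit)
    subgoal using minimizer by blast
    subgoal using split_form by blast
    subgoal using approximation by blast
    subgoal using convex by blast
    subgoal by (rule duality)
    done
qed

end
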